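(* There exists a computable linear ordering $(\mathbb{N},\sqsubseteq)$ with no computable infinite monotone (ascending or descending) sequence, such that the Lebesgue measure of the class of oracles $X\in2^{\mathbb{N}}$ computing an infinite $\sqsubseteq$-increasing sequence is $1$. *)

theory Defs
  imports "HOL-Probability.Probability"
begin

text \<open>
  Kleene's partial recursive functionals: \<open>Oracle\<close> is the characteristic function of the oracle.
  Terms are untyped with respect to arity; a term denotes a partial \<open>k\<close>-ary function for each \<open>k\<close>,
  namely its evaluation on argument lists of length \<open>k\<close>.
\<close>

datatype recf =
    Zero
  | Succ
  | Proj nat
  | Oracle
  | Comp recf "recf list"
  | PrimRec recf recf
  | Mu recf

inductive eval :: "(nat \<Rightarrow> bool) \<Rightarrow> recf \<Rightarrow> nat list \<Rightarrow> nat \<Rightarrow> bool" for X :: "nat \<Rightarrow> bool" where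
  Zero: "eval X Zero xs 0"
| Succ: "eval X Succ [x] (Suc x)"
| Proj: "i < length xs \<Longrightarrow> eval X (Proj i) xs (xs ! i)"
| Oracle: "eval X Oracle [x] (of_bool (X x))"
| Comp: "list_all2 (\<lambda>g y. eval X g xs y) gs ys \<Longrightarrow> eval X f ys z \<Longrightarrow> eval X (Comp f gs) xs z"
| PrimRec_0: "eval X f xs y \<Longrightarrow> eval X (PrimRec f g) (0 # xs) y"
| PrimRec_Suc: "eval X (PrimRec f g) (n # xs) r \<Longrightarrow> eval X g (n # r # xs) y \<Longrightarrow>
    eval X (PrimRec f g) (Suc n # xs) y"
| Mu: "eval X f (n # xs) 0 \<Longrightarrow> (\<forall>m<n. \<exists>y. eval X f (m # xs) y \<and> y > 0) \<Longrightarrow> eval X (Mu f) xs n"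

inductive_cases eval_ZeroE: "eval X Zero xs y"
inductive_cases eval_SuccE: "eval X Succ xs y"
inductive_cases eval_ProjE: "eval X (Proj i) xs y"
inductive_cases eval_OracleE: "eval X Oracle xs y"
inductive_cases eval_CompE: "eval X (Comp f gs) xs y"
inductive_cases eval_PrimRec_0E: "eval X (PrimRec f g) (0 # xs) y"
inductive_cases eval_PrimRec_SucE: "eval X (PrimRec f g) (Suc n # xs) y"
inductive_cases eval_MuE: "eval X (Mu f) xs y"

lemma eval_deterministic: "eval X e xs y \<Longrightarrow> eval X e xs z \<Longrightarrow> y = z"
proof (induction arbitrary: z rule: eval.induct)
  case (Zero xs)
  then show ?case by (rule eval_ZeroE) simp
next
  case (Succ x)
  then show ?case by (rule eval_SuccE) simp
next
  case (Proj i xs)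
  from Proj.prems show ?case by (rule eval_ProjE) simp
next
  case (Oracle x)
  then show ?case by (rule eval_OracleE) simp
next
  case (Comp xs gs ys f y)
  from Comp.prems obtain ys' where ys': "list_all2 (\<lambda>g y. eval X g xs y) gs ys'" "eval X f ys' z"
    by (rule eval_CompE)
  have "ys = ys'"
  proof (rule nth_equalityI)
    show "length ys = length ys'"
      using list_all2_lengthD[OF Comp.IH(1)] list_all2_lengthD[OF ys'(1)] by simp
  next
    fix i assume i: "i < length ys"
    then have "i < length gs"
      using list_all2_lengthD[OF ys'(1)] list_all2_lengthD[OF Comp.IH(1)] by simp
    from list_all2_nthD[OF Comp.IH(1) this] list_all2_nthD[OF ys'(1) this]
    show "ys ! i = ys' ! i" by blast
  qed
  with ys'(2) have "eval X f ys z" by (simp only:)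
  then show ?case by (rule Comp.IH(2))
next
  case (PrimRec_0 f xs y g)
  from PrimRec_0.prems have "eval X f xs z" by (rule eval_PrimRec_0E)
  then show ?case by (rule PrimRec_0.IH)
next
  case (PrimRec_Suc f g n xs r y)
  from PrimRec_Suc.prems obtain r' where
    r': "eval X (PrimRec f g) (n # xs) r'" "eval X g (n # r' # xs) z"
    by (rule eval_PrimRec_SucE)
  from PrimRec_Suc.IH(1)[OF r'(1)] r'(2) show ?case
    by (intro PrimRec_Suc.IH(2)) simp
next
  case (Mu f n xs)
  from Mu.prems have z: "eval X f (z # xs) 0" "\<forall>m<z. \<exists>y. eval X f (m # xs) y \<and> y > 0"
    by (blast elim: eval_MuE)+
  have "\<not> n < z" using z(2) Mu.IH(1) by (blast dest: less_imp_neq)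
  moreover have "\<not> z < n" using z(1) Mu.IH(2) by (blast dest: less_imp_neq)
  ultimately show ?case by simp
qed

primrec oracle_free :: "recf \<Rightarrow> bool" where
  "oracle_free Zero \<longleftrightarrow> True"
| "oracle_free Succ \<longleftrightarrow> True"
| "oracle_free (Proj i) \<longleftrightarrow> True"
| "oracle_free Oracle \<longleftrightarrow> False"
| "oracle_free (Comp f gs) \<longleftrightarrow> oracle_free f \<and> list_all id (map oracle_free gs)"
| "oracle_free (PrimRec f g) \<longleftrightarrow> oracle_free f \<and> oracle_free g"
| "oracle_free (Mu f) \<longleftrightarrow> oracle_free f"

definition computable_in :: "(nat \<Rightarrow> bool) \<Rightarrow> (nat \<Rightarrow> nat) \<Rightarrow> bool" where
  "computable_in X f \<longleftrightarrow> (\<exists>e. \<forall>n. eval X e [n] (f n))"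

text \<open>For oracle-free terms the first argument of \<^const>\<open>eval\<close> is irrelevant.\<close>

definition computable :: "(nat \<Rightarrow> nat) \<Rightarrow> bool" where
  "computable f \<longleftrightarrow> (\<exists>e. oracle_free e \<and> (\<forall>n. eval (\<lambda>_. False) e [n] (f n)))"

definition computable_rel :: "nat rel \<Rightarrow> bool" where
  "computable_rel r \<longleftrightarrow>
    (\<exists>e. oracle_free e \<and> (\<forall>x y. eval (\<lambda>_. False) e [x, y] (of_bool ((x, y) \<in> r))))"

text \<open>For a reflexive order \<open>r\<close>, the relation \<^term>\<open>r - Id\<close> is its strict part.\<close>

definition ascending :: "nat rel \<Rightarrow> (nat \<Rightarrow> nat) \<Rightarrow> bool" where
  "ascending r f \<longleftrightarrow> (\<forall>m n. m < n \<longrightarrow> (f m, f n) \<in> r - Id)"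

definition descending :: "nat rel \<Rightarrow> (nat \<Rightarrow> nat) \<Rightarrow> bool" where
  "descending r f \<longleftrightarrow> (\<forall>m n. m < n \<longrightarrow> (f n, f m) \<in> r - Id)"

text \<open>
  Lebesgue (fair coin) measure on Cantor space. Since \<^const>\<open>emeasure\<close> is 0 outside the
  \<open>\<sigma>\<close>-algebra, a set of measure 1 is in particular measurable.
\<close>

definition cantor_measure :: "(nat \<Rightarrow> bool) measure" where
  "cantor_measure = (\<Pi>\<^sub>M i\<in>UNIV. measure_pmf (bernoulli_pmf (1 / 2)))"

end

theory Submission
  imports Defs
begin

text \<open>
  The order consists of dyadic rationals \<open>i / 2 ^ s\<close> in \<open>[0, 1)\<close>, enumerated level by level. At level
  \<open>s\<close>, each of the first programs \<open>e\<close> forbids all new elements in the dyadic interval of length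
  \<open>2 ^ - (e + 2)\<close> containing its value at the largest argument seen so far. A monotone sequence
  eventually stays in one dyadic interval of each length; if program \<open>e\<close> computes it, this interval
  receives no elements from some level on, so it is finite and the sequence cannot be injective.

  On the other hand, read an oracle \<open>X\<close> as a real in \<open>[0, 1]\<close>. Its truncations at the levels \<open>s\<close> are
  increasing, and the one at level \<open>s\<close> is forbidden with probability at most
  \<open>\<Sum>e. 2 ^ - (e + 2) = 1 / 2\<close>. Hence with probability at least \<open>1 / 2\<close> infinitely many of them belong
  to the order, and \<open>X\<close> computes an ascending sequence. Computing one is a tail event, so Kolmogorov's
  zero-one law raises the probability to \<open>1\<close>.
\<close>

section \<open>Closure properties of the computable functions\<close>

text \<open>The flag \<open>b\<close> lets one set of closure rules serve both notions of
  computability: \<open>True\<close> admits oracle queries, \<open>False\<close> demands an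
  oracle-free program.\<close>

definition rec_in :: "bool \<Rightarrow> (nat \<Rightarrow> bool) \<Rightarrow> nat \<Rightarrow> (nat list \<Rightarrow> nat) \<Rightarrow> bool" where
  "rec_in b X k F \<longleftrightarrow>
    (\<exists>e. (b \<or> oracle_free e) \<and> (\<forall>xs. length xs = k \<longrightarrow> eval X e xs (F xs)))"

lemma rec_in_cong: "rec_in b X k F \<Longrightarrow> (\<And>xs. length xs = k \<Longrightarrow> F xs = G xs) \<Longrightarrow> rec_in b X k G"
  unfolding rec_in_def by metis

lemma rec_in_zero: "rec_in b X k (\<lambda>_. 0)"
  unfolding rec_in_def by (rule exI[of _ recf.Zero]) (auto intro: eval.intros)

lemma rec_in_proj: "i < k \<Longrightarrow> rec_in b X k (\<lambda>xs. xs ! i)"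
  unfolding rec_in_def by (rule exI[of _ "recf.Proj i"]) (auto intro: eval.intros)

lemma rec_in_comp:
  assumes "rec_in b X (length Gs) F" "\<And>G. G \<in> set Gs \<Longrightarrow> rec_in b X k G"
  shows "rec_in b X k (\<lambda>xs. F (map (\<lambda>G. G xs) Gs))"
proof -
  obtain f where f: "b \<or> oracle_free f" "\<And>xs. length xs = length Gs \<Longrightarrow> eval X f xs (F xs)"
    using assms(1) unfolding rec_in_def by auto
  have "\<forall>G\<in>set Gs. \<exists>e. (b \<or> oracle_free e) \<and> (\<forall>xs. length xs = k \<longrightarrow> eval X e xs (G xs))"
    using assms(2) unfolding rec_in_def by auto
  then obtain g where g: "\<And>G. G \<in> set Gs \<Longrightarrow> b \<or> oracle_free (g G)"
    "\<And>G xs. G \<in> set Gs \<Longrightarrow> length xs = k \<Longrightarrow> eval X (g G) xs (G xs)"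
    by metis
  have "eval X (recf.Comp f (map g Gs)) xs (F (map (\<lambda>G. G xs) Gs))" if "length xs = k" for xs
    using that f g by (intro eval.Comp[of _ _ _ "map (\<lambda>G. G xs) Gs"]) (auto simp: list_all2_conv_all_nth)
  moreover have "b \<or> oracle_free (recf.Comp f (map g Gs))"
    using f g by (auto simp: list_all_iff)
  ultimately show ?thesis unfolding rec_in_def by blast
qed

lemma rec_in_comp1: "rec_in b X 1 (\<lambda>xs. f (xs ! 0)) \<Longrightarrow> rec_in b X k G \<Longrightarrow> rec_in b X k (\<lambda>xs. f (G xs))"
  using rec_in_comp[of b X "[G]" "\<lambda>xs. f (xs ! 0)"] by simp

lemma rec_in_comp2:
  "rec_in b X 2 (\<lambda>xs. f (xs ! 0) (xs ! 1)) \<Longrightarrow> rec_in b X k G \<Longrightarrow> rec_in b X k H \<Longrightarrow>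
    rec_in b X k (\<lambda>xs. f (G xs) (H xs))"
  using rec_in_comp[of b X "[G, H]" "\<lambda>xs. f (xs ! 0) (xs ! 1)" k] by (auto simp: numeral_2_eq_2)

lemma rec_in_Suc: "rec_in b X k F \<Longrightarrow> rec_in b X k (\<lambda>xs. Suc (F xs))"
proof (rule rec_in_comp1[of b X Suc])
  have "eval X recf.Succ xs (Suc (xs ! 0))" if "length xs = 1" for xs
    using that by (cases xs) (auto intro: eval.intros)
  then show "rec_in b X 1 (\<lambda>xs. Suc (xs ! 0))"
    unfolding rec_in_def by (intro exI[of _ recf.Succ]) auto
qed

lemma rec_in_oracle: "rec_in True X k F \<Longrightarrow> rec_in True X k (\<lambda>xs. of_bool (X (F xs)))"
proof (rule rec_in_comp1[of True X "\<lambda>x. of_bool (X x)"])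
  have "eval X recf.Oracle xs (of_bool (X (xs ! 0)))" if "length xs = 1" for xs
    using that eval.Oracle by (cases xs) auto
  then show "rec_in True X 1 (\<lambda>xs. of_bool (X (xs ! 0)))"
    unfolding rec_in_def by (intro exI[of _ recf.Oracle]) auto
qed

lemma rec_in_prim_rec:
  assumes "rec_in b X k F" "rec_in b X (Suc (Suc k)) G" "rec_in b X k N"
  shows "rec_in b X k (\<lambda>xs. rec_nat (F xs) (\<lambda>i r. G (i # r # xs)) (N xs))"
proof -
  obtain f where f: "b \<or> oracle_free f" "\<And>xs. length xs = k \<Longrightarrow> eval X f xs (F xs)"
    using assms(1) unfolding rec_in_def by auto
  obtain g where g: "b \<or> oracle_free g"
      "\<And>xs. length xs = Suc (Suc k) \<Longrightarrow> eval X g xs (G xs)"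
    using assms(2) unfolding rec_in_def by auto
  define H where "H xs = rec_nat (F (tl xs)) (\<lambda>i r. G (i # r # tl xs)) (hd xs)" for xs
  have "eval X (recf.PrimRec f g) (n # xs) (H (n # xs))" if "length xs = k" for n xs
    by (induction n) (use that f g in \<open>auto simp: H_def intro!: eval.intros\<close>)
  then have "eval X (recf.PrimRec f g) xs (H xs)" if "length xs = Suc k" for xs
    using that by (cases xs) auto
  then have "rec_in b X (Suc k) H"
    unfolding rec_in_def using f g by (intro exI[of _ "recf.PrimRec f g"]) auto
  \<comment> \<open>Primitive recursion consumes the head of its argument list, so the bound
    \<open>N\<close> is put in front of the \<open>k\<close> projections that reproduce
    \<open>xs\<close>.\<close>
  then have "rec_in b X k (\<lambda>xs. H (map (\<lambda>G. G xs) (N # map (\<lambda>i xs. xs ! i) [0..<k])))"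
    using assms(3) by (intro rec_in_comp) (auto intro: rec_in_proj)
  then show ?thesis
    by (rule rec_in_cong) (auto simp: H_def comp_def intro!: arg_cong2[of _ _ _ _ "\<lambda>x y. rec_nat x y _"]
        simp: map_nth[unfolded comp_def] cong: map_cong)
qed

text \<open>Totality of \<open>F\<close> supplies the positive values that \<open>Mu\<close> demands
  below the least zero; the second hypothesis makes the search stop.\<close>

lemma rec_in_Least:
  assumes "rec_in b X (Suc k) F" "\<And>xs. length xs = k \<Longrightarrow> \<exists>n. F (n # xs) = 0"
  shows "rec_in b X k (\<lambda>xs. LEAST n. F (n # xs) = 0)"
proof -
  obtain f where f: "b \<or> oracle_free f" "\<And>xs. length xs = Suc k \<Longrightarrow> eval X f xs (F xs)"
    using assms(1) unfolding rec_in_def by auto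
  have "eval X (recf.Mu f) xs (LEAST n. F (n # xs) = 0)" (is "eval X _ xs ?n")
    if k: "length xs = k" for xs
  proof (rule eval.Mu)
    have "F (?n # xs) = 0" using LeastI_ex[OF assms(2)[OF k]] .
    moreover have "eval X f (?n # xs) (F (?n # xs))" using f(2) k by simp
    ultimately show "eval X f (?n # xs) 0" by simp
    show "\<forall>m<?n. \<exists>y. eval X f (m # xs) y \<and> y > 0"
    proof (intro allI impI exI conjI)
      fix m assume "m < ?n"
      then show "F (m # xs) > 0" using not_less_Least by blast
      show "eval X f (m # xs) (F (m # xs))" using f(2) k by simp
    qed
  qed
  then show ?thesis using f(1) unfolding rec_in_def by (intro exI[of _ "recf.Mu f"]) auto
qed

section \<open>Arithmetic and inversion of the pairing function\<close>

lemma rec_in_add: "rec_in b X k F \<Longrightarrow> rec_in b X k G \<Longrightarrow> rec_in b X k (\<lambda>xs. F xs + G xs)"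
proof (rule rec_in_comp2[of b X "(+)"])
  have "rec_in b X 2 (\<lambda>xs. rec_nat (xs ! 0) (\<lambda>i r. Suc ((i # r # xs) ! 1)) (xs ! 1))"
    by (rule rec_in_prim_rec[where G = "\<lambda>ys. Suc (ys ! 1)"]) (intro rec_in_Suc rec_in_proj; simp)+
  moreover have "rec_nat a (\<lambda>i r. Suc r) c = a + c" for a c :: nat by (induction c) auto
  ultimately show "rec_in b X 2 (\<lambda>xs. xs ! 0 + xs ! 1)" by simp
qed

lemma rec_in_mult: "rec_in b X k F \<Longrightarrow> rec_in b X k G \<Longrightarrow> rec_in b X k (\<lambda>xs. F xs * G xs)"
proof (rule rec_in_comp2[of b X "(*)"])
  have "rec_in b X 2 (\<lambda>xs. rec_nat 0 (\<lambda>i r. (i # r # xs) ! 1 + (i # r # xs) ! 2) (xs ! 1))"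
    by (rule rec_in_prim_rec[where G = "\<lambda>ys. ys ! 1 + ys ! 2"])
      (intro rec_in_zero rec_in_add rec_in_proj; simp)+
  moreover have "rec_nat 0 (\<lambda>i r. r + a) c = a * c" for a c :: nat by (induction c) auto
  ultimately show "rec_in b X 2 (\<lambda>xs. xs ! 0 * xs ! 1)" by (simp add: numeral_2_eq_2)
qed

lemma rec_in_diff: "rec_in b X k F \<Longrightarrow> rec_in b X k G \<Longrightarrow> rec_in b X k (\<lambda>xs. F xs - G xs)"
proof (rule rec_in_comp2[of b X "(-)"])
  have "rec_in b X 1 (\<lambda>xs. rec_nat 0 (\<lambda>i r. (i # r # xs) ! 0) (xs ! 0))"
    by (rule rec_in_prim_rec[where G = "\<lambda>ys. ys ! 0"]) (intro rec_in_zero rec_in_proj; simp)+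
  moreover have "rec_nat 0 (\<lambda>i r. i) c = c - 1" for c :: nat by (cases c) auto
  ultimately have pred: "rec_in b X 1 (\<lambda>xs. xs ! 0 - 1)" by simp
  have "rec_in b X 2 (\<lambda>xs. rec_nat (xs ! 0) (\<lambda>i r. (i # r # xs) ! 1 - 1) (xs ! 1))"
    by (rule rec_in_prim_rec[where G = "\<lambda>ys. ys ! 1 - 1"])
      (intro rec_in_comp1[OF pred] rec_in_proj; simp)+
  moreover have "rec_nat a (\<lambda>i r. r - 1) c = a - c" for a c :: nat by (induction c) auto
  ultimately show "rec_in b X 2 (\<lambda>xs. xs ! 0 - xs ! 1)" by simp
qed

lemma rec_in_triangle: "rec_in b X k F \<Longrightarrow> rec_in b X k (\<lambda>xs. triangle (F xs))"
proof (rule rec_in_comp1[of b X triangle])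
  have "rec_in b X 1 (\<lambda>xs. rec_nat 0 (\<lambda>i r. (i # r # xs) ! 1 + Suc ((i # r # xs) ! 0)) (xs ! 0))"
    by (rule rec_in_prim_rec[where G = "\<lambda>ys. ys ! 1 + Suc (ys ! 0)"])
      (intro rec_in_zero rec_in_add rec_in_Suc rec_in_proj; simp)+
  moreover have "rec_nat 0 (\<lambda>i r. r + Suc i) c = triangle c" for c :: nat by (induction c) auto
  ultimately show "rec_in b X 1 (\<lambda>xs. triangle (xs ! 0))" by simp
qed

lemma triangle_mono: "m \<le> n \<Longrightarrow> triangle m \<le> triangle n"
  unfolding triangle_def by (intro div_le_mono mult_le_mono) auto

lemma triangle_ge: "n \<le> triangle n"
  by (induction n) auto

text \<open>Cantor pairing maps \<open>(m, s - m)\<close> to \<open>triangle s + m\<close>, and this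
  recovers the diagonal \<open>s\<close>. With truncated subtraction, \<open>Suc n - t = 0\<close>
  encodes \<open>n < t\<close> in the form that minimization accepts.\<close>

lemma Least_triangle:
  assumes "m \<le> s"
  shows "(LEAST w. Suc (triangle s + m) - triangle (Suc w) = 0) = s"
proof (rule Least_equality)
  show "Suc (triangle s + m) - triangle (Suc s) = 0" using assms by simp
  fix w assume w: "Suc (triangle s + m) - triangle (Suc w) = 0"
  show "s \<le> w"
  proof (rule ccontr)
    assume "\<not> s \<le> w"
    then have "triangle (Suc w) \<le> triangle s" by (intro triangle_mono) auto
    then show False using w by simp
  qed
qed

lemma rec_in_prod_decode:
  assumes "rec_in b X k F"
  shows rec_in_fst: "rec_in b X k (\<lambda>xs. fst (prod_decode (F xs)))"
    and rec_in_snd: "rec_in b X k (\<lambda>xs. snd (prod_decode (F xs)))"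
proof -
  \<comment> \<open>\<open>W n\<close> is the diagonal of \<open>n\<close>, the sum of its two
    components; both components follow from it by subtraction.\<close>
  define W where "W n = (LEAST w. Suc n - triangle (Suc w) = 0)" for n
  have "rec_in b X 1 (\<lambda>xs. LEAST w. Suc ((w # xs) ! 1) - triangle (Suc ((w # xs) ! 0)) = 0)"
  proof (rule rec_in_Least)
    show "rec_in b X (Suc 1) (\<lambda>xs. Suc (xs ! 1) - triangle (Suc (xs ! 0)))"
      by (intro rec_in_diff rec_in_triangle rec_in_Suc rec_in_proj; simp)
    show "\<exists>n. Suc ((n # xs) ! 1) - triangle (Suc ((n # xs) ! 0)) = 0" for xs
      using triangle_ge[of "xs ! 0"] by (intro exI[of _ "xs ! 0"]) simp
  qed
  then have W: "rec_in b X 1 (\<lambda>xs. W (xs ! 0))" by (simp add: W_def)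
  have W_eq: "W n = fst (prod_decode n) + snd (prod_decode n)" for n
  proof -
    obtain x y where xy: "prod_decode n = (x, y)" by force
    then have "n = triangle (x + y) + x"
      using prod_decode_inverse[of n] by (simp add: prod_encode_def)
    with xy Least_triangle[of x "x + y"] show ?thesis by (simp add: W_def)
  qed
  have eq: "n = triangle (W n) + fst (prod_decode n)" for n
    using prod_decode_inverse[of n] by (cases "prod_decode n") (simp add: prod_encode_def W_eq)
  have fst_eq: "fst (prod_decode n) = n - triangle (W n)" for n
    using eq[of n] by linarith
  have snd_eq: "snd (prod_decode n) = W n - (n - triangle (W n))" for n
    using W_eq[of n] fst_eq[of n] by linarith
  show "rec_in b X k (\<lambda>xs. fst (prod_decode (F xs)))"
    unfolding fst_eq by (intro rec_in_diff rec_in_triangle rec_in_comp1[OF W] assms)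
  show "rec_in b X k (\<lambda>xs. snd (prod_decode (F xs)))"
    unfolding snd_eq by (intro rec_in_diff rec_in_triangle rec_in_comp1[OF W] assms)
qed

text \<open>
  Restricting to unary functions, with further arguments coded by \<^const>\<open>prod_encode\<close>, makes the
  closure rules compositional under binders: a bound variable and its context become the two
  projections of a single argument.
\<close>

definition pfst :: "nat \<Rightarrow> nat" where "pfst p = fst (prod_decode p)"
definition psnd :: "nat \<Rightarrow> nat" where "psnd p = snd (prod_decode p)"
definition pair :: "nat \<Rightarrow> nat \<Rightarrow> nat" where "pair a c = prod_encode (a, c)"

lemma pfst_pair [simp]: "pfst (pair a c) = a"
  and psnd_pair [simp]: "psnd (pair a c) = c"
  and pair_eq_iff [simp]: "pair a c = pair a' c' \<longleftrightarrow> a = a' \<and> c = c'"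
  and pair_pfst_psnd [simp]: "pair (pfst p) (psnd p) = p"
  by (simp_all add: pfst_def psnd_def pair_def)

lemma le_pair_left: "a \<le> pair a c"
  and le_pair_right: "c \<le> pair a c"
  by (simp_all add: pair_def le_prod_encode_1 le_prod_encode_2)

lemma rec_in_pair:
  "rec_in b X k F \<Longrightarrow> rec_in b X k G \<Longrightarrow> rec_in b X k (\<lambda>xs. pair (F xs) (G xs))"
  unfolding pair_def prod_encode_def by (auto intro!: rec_in_add rec_in_triangle)

definition crec :: "bool \<Rightarrow> (nat \<Rightarrow> bool) \<Rightarrow> (nat \<Rightarrow> nat) \<Rightarrow> bool" where
  "crec b X f \<longleftrightarrow> rec_in b X 1 (\<lambda>xs. f (xs ! 0))"

abbreviation cdec :: "bool \<Rightarrow> (nat \<Rightarrow> bool) \<Rightarrow> (nat \<Rightarrow> bool) \<Rightarrow> bool" where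
  "cdec b X P \<equiv> crec b X (\<lambda>x. of_bool (P x))"

lemma crec_iff: "crec b X f \<longleftrightarrow> (\<exists>e. (b \<or> oracle_free e) \<and> (\<forall>n. eval X e [n] (f n)))"
proof -
  have "(\<forall>xs. length xs = 1 \<longrightarrow> eval X e xs (f (xs ! 0))) \<longleftrightarrow> (\<forall>n. eval X e [n] (f n))" for e
    by (auto simp: length_Suc_conv)
  then show ?thesis by (simp add: crec_def rec_in_def)
qed

lemma computable_iff_crec: "computable f \<longleftrightarrow> crec False (\<lambda>_. False) f"
  by (simp add: computable_def crec_iff)

lemma computable_in_iff_crec: "computable_in X f \<longleftrightarrow> crec True X f"
  by (simp add: computable_in_def crec_iff)

named_theorems crec_intros

lemma crec_id [crec_intros]: "crec b X (\<lambda>x. x)"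
  unfolding crec_def by (rule rec_in_proj) simp

lemma crec_const [crec_intros]: "crec b X (\<lambda>_. c)"
  unfolding crec_def by (induction c) (auto intro: rec_in_zero rec_in_Suc)

lemma crec_comp: "crec b X f \<Longrightarrow> crec b X g \<Longrightarrow> crec b X (\<lambda>x. f (g x))"
  unfolding crec_def by (rule rec_in_comp1)

lemma crec_arith [crec_intros]:
  assumes "crec b X f" "crec b X g"
  shows "crec b X (\<lambda>x. f x + g x)" "crec b X (\<lambda>x. f x - g x)" "crec b X (\<lambda>x. f x * g x)"
    "crec b X (\<lambda>x. pair (f x) (g x))"
  using assms unfolding crec_def
  by (auto intro!: rec_in_add rec_in_diff rec_in_mult rec_in_pair)

lemma crec_unary [crec_intros]:
  assumes "crec b X f"
  shows "crec b X (\<lambda>x. Suc (f x))" "crec b X (\<lambda>x. pfst (f x))" "crec b X (\<lambda>x. psnd (f x))"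
  using assms unfolding crec_def pfst_def psnd_def
  by (auto intro!: rec_in_Suc rec_in_fst rec_in_snd)

lemma crec_oracle: "crec True X f \<Longrightarrow> cdec True X (\<lambda>x. X (f x))"
  unfolding crec_def by (rule rec_in_oracle)

text \<open>The step function sees a single number coding the index, the previous value and the
  context \<open>x\<close>, so that its body may depend on \<open>x\<close>.\<close>

lemma crec_rec_nat [crec_intros]:
  assumes "crec b X f" "crec b X (\<lambda>p. h (pfst p) (pfst (psnd p)) (psnd (psnd p)))" "crec b X n"
  shows "crec b X (\<lambda>x. rec_nat (f x) (\<lambda>i r. h i r x) (n x))"
proof -
  let ?h = "\<lambda>p. h (pfst p) (pfst (psnd p)) (psnd (psnd p))"
  have "rec_in b X (Suc (Suc 1)) (\<lambda>xs. ?h (pair (xs ! 0) (pair (xs ! 1) (xs ! 2))))"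
    by (rule rec_in_comp1[OF assms(2)[unfolded crec_def]]) (intro rec_in_pair rec_in_proj; simp)
  then have "rec_in b X (Suc (Suc 1)) (\<lambda>xs. h (xs ! 0) (xs ! 1) (xs ! 2))" by simp
  from rec_in_prim_rec[OF _ this, of "\<lambda>xs. f (xs ! 0)" "\<lambda>xs. n (xs ! 0)"] assms(1,3)
  show ?thesis by (simp add: crec_def numeral_2_eq_2)
qed

section \<open>Decidable predicates, bounded quantifiers and search\<close>

lemma cdec_not [crec_intros]: "cdec b X P \<Longrightarrow> cdec b X (\<lambda>x. \<not> P x)"
proof -
  assume "cdec b X P"
  then have "crec b X (\<lambda>x. 1 - of_bool (P x))" by (intro crec_intros)
  moreover have "1 - of_bool (P x) = (of_bool (\<not> P x) :: nat)" for x by simp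
  ultimately show ?thesis by simp
qed

lemma cdec_conj [crec_intros]: "cdec b X P \<Longrightarrow> cdec b X Q \<Longrightarrow> cdec b X (\<lambda>x. P x \<and> Q x)"
  unfolding of_bool_conj by (intro crec_intros)

lemma cdec_disj [crec_intros]:
  assumes "cdec b X P" "cdec b X Q" shows "cdec b X (\<lambda>x. P x \<or> Q x)"
proof -
  have "cdec b X (\<lambda>x. \<not> (\<not> P x \<and> \<not> Q x))" by (intro crec_intros assms)
  then show ?thesis by simp
qed

lemma cdec_imp [crec_intros]: "cdec b X P \<Longrightarrow> cdec b X Q \<Longrightarrow> cdec b X (\<lambda>x. P x \<longrightarrow> Q x)"
  unfolding imp_conv_disj by (intro crec_intros)

lemma cdec_less [crec_intros]:
  assumes "crec b X f" "crec b X g" shows "cdec b X (\<lambda>x. f x < g x)"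
proof -
  \<comment> \<open>Under truncated subtraction the outer \<open>1 - (1 - _)\<close> collapses a
    positive difference to 1.\<close>
  have "crec b X (\<lambda>x. 1 - (1 - (g x - f x)))" by (intro crec_intros assms)
  moreover have "(\<lambda>x. 1 - (1 - (g x - f x))) = (\<lambda>x. of_bool (f x < g x))" by fastforce
  ultimately show ?thesis by simp
qed

lemma cdec_le [crec_intros]: "crec b X f \<Longrightarrow> crec b X g \<Longrightarrow> cdec b X (\<lambda>x. f x \<le> g x)"
  unfolding linorder_not_less[symmetric] by (intro crec_intros)

lemma cdec_eq [crec_intros]: "crec b X f \<Longrightarrow> crec b X g \<Longrightarrow> cdec b X (\<lambda>x. f x = g x)"
  unfolding order_eq_iff by (intro crec_intros)

lemma cdec_iff [crec_intros]: "cdec b X P \<Longrightarrow> cdec b X Q \<Longrightarrow> cdec b X (\<lambda>x. P x \<longleftrightarrow> Q x)"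
  unfolding iff_conv_conj_imp by (intro crec_intros)

lemma crec_if [crec_intros]:
  assumes "cdec b X P" "crec b X f" "crec b X g"
  shows "crec b X (\<lambda>x. if P x then f x else g x)"
proof -
  have "crec b X (\<lambda>x. of_bool (P x) * f x + (1 - of_bool (P x)) * g x)" by (intro crec_intros assms)
  moreover have "of_bool (P x) * f x + (1 - of_bool (P x)) * g x = (if P x then f x else g x)" for x
    by simp
  ultimately show ?thesis by simp
qed

lemma cdec_ball [crec_intros]:
  assumes P: "cdec b X (\<lambda>p. P (pfst p) (psnd p))" and "crec b X n"
  shows "cdec b X (\<lambda>x. \<forall>i<n x. P i x)"
proof -
  \<comment> \<open>Inside the recursion the context sits behind the accumulated product, hence the
    second projection.\<close>
  have "cdec b X (\<lambda>p. P (pfst p) (psnd (psnd p)))"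
    using crec_comp[OF P, of "\<lambda>p. pair (pfst p) (psnd (psnd p))"] by (simp add: crec_intros)
  then have "crec b X (\<lambda>x. rec_nat 1 (\<lambda>i r. r * of_bool (P i x)) (n x))"
    by (intro crec_intros assms) simp_all
  moreover have "rec_nat 1 (\<lambda>i r. r * of_bool (P i x)) m = (of_bool (\<forall>i<m. P i x) :: nat)" for x m
    by (induction m) (auto simp: less_Suc_eq)
  ultimately show ?thesis by simp
qed

lemma cdec_bex [crec_intros]:
  assumes "cdec b X (\<lambda>p. P (pfst p) (psnd p))" "crec b X n"
  shows "cdec b X (\<lambda>x. \<exists>i<n x. P i x)"
proof -
  have "cdec b X (\<lambda>x. \<not> (\<forall>i<n x. \<not> P i x))" by (intro crec_intros assms)
  then show ?thesis by simp
qed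

lemma crec_Least:
  assumes P: "cdec b X (\<lambda>p. P (pfst p) (psnd p))" and ex: "\<And>x. \<exists>n. P n x"
  shows "crec b X (\<lambda>x. LEAST n. P n x)"
proof -
  have "cdec b X (\<lambda>p. \<not> P (pfst p) (psnd p))" by (intro crec_intros P)
  then have "rec_in b X (Suc 1)
      (\<lambda>xs. of_bool (\<not> P (pfst (pair (xs ! 0) (xs ! 1))) (psnd (pair (xs ! 0) (xs ! 1)))))"
    unfolding crec_def by (rule rec_in_comp1) (intro rec_in_pair rec_in_proj; simp)
  then have "rec_in b X (Suc 1) (\<lambda>xs. of_bool (\<not> P (xs ! 0) (xs ! 1)))" by simp
  from rec_in_Least[OF this] ex show ?thesis by (simp add: crec_def)
qed

lemma crec_power [crec_intros]:
  assumes "crec b X f" "crec b X g" shows "crec b X (\<lambda>x. f x ^ g x)"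
proof -
  have "crec b X (\<lambda>x. rec_nat 1 (\<lambda>i r. f x * r) (g x))"
    by (intro crec_intros assms crec_comp[OF assms(1)])
  moreover have "rec_nat 1 (\<lambda>i r. c * r) m = c ^ m" for c m :: nat by (induction m) auto
  ultimately show ?thesis by simp
qed

lemma crec_div [crec_intros]:
  assumes f: "crec b X f" and g: "crec b X g" shows "crec b X (\<lambda>x. f x div g x)"
proof -
  \<comment> \<open>The disjunct \<open>g x = 0\<close> stops the search at 0, which is also the
    value of division by zero.\<close>
  have "crec b X (\<lambda>x. LEAST q. g x = 0 \<or> f x < Suc q * g x)"
  proof (rule crec_Least)
    show "cdec b X (\<lambda>p. g (psnd p) = 0 \<or> f (psnd p) < Suc (pfst p) * g (psnd p))"
      by (intro crec_intros crec_comp[OF f] crec_comp[OF g])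
    show "\<exists>q. g x = 0 \<or> f x < Suc q * g x" for x
      by (metis dividend_less_times_div mult.commute mult_Suc_right neq0_conv)
  qed
  moreover have "(LEAST q. c = 0 \<or> a < Suc q * c) = a div c" for a c :: nat
  proof (rule Least_equality)
    show "c = 0 \<or> a < Suc (a div c) * c"
      by (metis dividend_less_times_div mult.commute mult_Suc_right neq0_conv)
    show "a div c \<le> q" if "c = 0 \<or> a < Suc q * c" for q
      using that by (cases "c = 0") (auto simp: less_mult_imp_div_less less_Suc_eq_le[symmetric])
  qed
  ultimately show ?thesis by simp
qed

text \<open>The increasing enumeration iterates the search for the next larger element, which
  succeeds because \<open>S\<close> is infinite.\<close>

lemma crec_enumerate:
  assumes S: "cdec b X (\<lambda>x. x \<in> S)" and "infinite S"
  shows "crec b X (enumerate S)"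
proof -
  define nxt where "nxt m = (LEAST s. s \<in> S \<and> m < s)" for m
  have nxt: "crec b X nxt"
    unfolding nxt_def
  proof (rule crec_Least)
    show "cdec b X (\<lambda>p. pfst p \<in> S \<and> psnd p < pfst p)"
      by (intro crec_intros crec_comp[OF S])
    show "\<exists>s. s \<in> S \<and> m < s" for m
      using \<open>infinite S\<close> by (metis infinite_nat_iff_unbounded)
  qed
  have "crec b X (\<lambda>n. rec_nat (enumerate S 0) (\<lambda>i r. nxt r) n)"
    by (intro crec_intros crec_comp[OF nxt])
  moreover have "rec_nat (enumerate S 0) (\<lambda>i r. nxt r) n = enumerate S n" for n
    by (induction n) (simp_all only: old.nat.rec enumerate_Suc''[OF \<open>infinite S\<close>] nxt_def)
  ultimately show ?thesis by simp
qed

section \<open>Enumerating the computable functions\<close>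

text \<open>
  Computations are coded as lists of judgments, latest first, each justified by its successors
  in the list. Checking such a list is decidable, and no universal evaluator has to be defined
  by recursion.
\<close>

definition lcons :: "nat \<Rightarrow> nat \<Rightarrow> nat" where "lcons x l = Suc (pair x l)"
definition lhd :: "nat \<Rightarrow> nat" where "lhd l = pfst (l - 1)"
definition ltl :: "nat \<Rightarrow> nat" where "ltl l = psnd (l - 1)"
definition ldrop :: "nat \<Rightarrow> nat \<Rightarrow> nat" where "ldrop i l = rec_nat l (\<lambda>_ r. ltl r) i"
text \<open>A list is never longer than its code, so bounding the position by \<open>l\<close>
  reaches every entry and keeps membership decidable.\<close>

definition lmem :: "nat \<Rightarrow> nat \<Rightarrow> bool" where
  "lmem x l \<longleftrightarrow> (\<exists>i<l. ldrop i l \<noteq> 0 \<and> lhd (ldrop i l) = x)"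

lemma list_encode_lcons [simp]: "list_encode (x # xs) = lcons x (list_encode xs)"
  by (simp add: lcons_def pair_def)

declare list_encode.simps(2) [simp del]

lemma lhd_lcons [simp]: "lhd (lcons x l) = x"
  and ltl_lcons [simp]: "ltl (lcons x l) = l"
  and lcons_neq_0 [simp]: "lcons x l \<noteq> 0" "0 \<noteq> lcons x l"
  and lcons_eq_iff [simp]: "lcons x l = lcons y m \<longleftrightarrow> x = y \<and> l = m"
  by (auto simp: lhd_def ltl_def lcons_def)

lemma ltl_0 [simp]: "ltl 0 = 0"
  by (simp add: ltl_def psnd_def prod_decode_def prod_decode_aux.simps)

lemma list_encode_eq_0_iff [simp]: "list_encode xs = 0 \<longleftrightarrow> xs = []"
  by (cases xs) auto

lemma ldrop_list_encode [simp]: "ldrop i (list_encode xs) = list_encode (drop i xs)"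
proof (induction i)
  case (Suc i)
  have "ldrop (Suc i) (list_encode xs) = ltl (list_encode (drop i xs))"
    using Suc by (simp add: ldrop_def)
  also have "\<dots> = list_encode (tl (drop i xs))" by (cases "drop i xs") auto
  finally show ?case by (simp add: tl_drop drop_Suc)
qed (simp add: ldrop_def)

lemma length_le_list_encode: "length xs \<le> list_encode xs"
proof (induction xs)
  case (Cons x xs)
  then show ?case using le_pair_right[of "list_encode xs" x] by (simp add: lcons_def)
qed simp

lemma lmem_list_encode [simp]: "lmem x (list_encode xs) \<longleftrightarrow> x \<in> set xs"
proof -
  have "(i < list_encode xs \<and> drop i xs \<noteq> [] \<and> lhd (list_encode (drop i xs)) = x) \<longleftrightarrow>
      i < length xs \<and> xs ! i = x" for i
    using length_le_list_encode[of xs] by (auto simp flip: Cons_nth_drop_Suc)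
  then show ?thesis unfolding lmem_def by (auto simp: in_set_conv_nth)
qed

lemma mem_less_list_encode: "x \<in> set xs \<Longrightarrow> x < list_encode xs"
proof (induction xs)
  case (Cons y xs)
  then show ?case
    using le_pair_left[of y "list_encode xs"] le_pair_right[of "list_encode xs" y] by (auto simp: lcons_def)
qed simp

lemma crec_list_unary [crec_intros]:
  assumes "crec b X f"
  shows "crec b X (\<lambda>x. lhd (f x))" "crec b X (\<lambda>x. ltl (f x))"
  unfolding lhd_def ltl_def by (intro crec_intros assms)+

lemma crec_list_binary [crec_intros]:
  assumes f: "crec b X f" and g: "crec b X g"
  shows "crec b X (\<lambda>x. lcons (f x) (g x))" "crec b X (\<lambda>x. ldrop (f x) (g x))"
    "cdec b X (\<lambda>x. lmem (f x) (g x))"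
  unfolding lcons_def ldrop_def lmem_def
  by (intro crec_intros f g crec_comp[OF f] crec_comp[OF g])+

text \<open>The first component tags the constructor. Tag 3, given to \<open>Oracle\<close>, is
  accepted by no clause of \<open>justified\<close>.\<close>

primrec enc :: "recf \<Rightarrow> nat" where
  "enc Zero = pair 0 0"
| "enc Succ = pair 1 0"
| "enc (Proj i) = pair 2 i"
| "enc Oracle = pair 3 0"
| "enc (Comp f gs) = pair 4 (pair (enc f) (list_encode (map enc gs)))"
| "enc (PrimRec f g) = pair 5 (pair (enc f) (enc g))"
| "enc (Mu f) = pair 6 (enc f)"

text \<open>The assertion that the program coded by \<open>c\<close> returns \<open>v\<close> on the
  argument list coded by \<open>a\<close>.\<close>

definition judg :: "nat \<Rightarrow> nat \<Rightarrow> nat \<Rightarrow> nat" where "judg c a v = pair c (pair a v)"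

lemma judg_eq_iff [simp]: "judg c a v = judg c' a' v' \<longleftrightarrow> c = c' \<and> a = a' \<and> v = v'"
  by (simp add: judg_def)

lemma crec_judg [crec_intros]:
  "crec b X f \<Longrightarrow> crec b X g \<Longrightarrow> crec b X h \<Longrightarrow> crec b X (\<lambda>x. judg (f x) (g x) (h x))"
  unfolding judg_def by (intro crec_intros)

text \<open>The evaluation rules read off codes, with the premises sought in \<open>l\<close>.
  Witnesses occur inside members of \<open>l\<close> and are therefore below \<open>l\<close>. In
  the clause for composition, the bound on \<open>i\<close> exceeds both list lengths, which forces
  them to agree.\<close>

definition justified :: "nat \<Rightarrow> nat \<Rightarrow> nat \<Rightarrow> nat \<Rightarrow> bool" where
  "justified c a v l \<longleftrightarrow>
    c = pair 0 0 \<and> v = 0 \<or>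
    c = pair 1 0 \<and> a = lcons (lhd a) 0 \<and> v = Suc (lhd a) \<or>
    pfst c = 2 \<and> ldrop (psnd c) a \<noteq> 0 \<and> v = lhd (ldrop (psnd c) a) \<or>
    pfst c = 4 \<and> (\<exists>ys<l. lmem (judg (pfst (psnd c)) ys v) l \<and>
      (\<forall>i<psnd (psnd c) + ys. (ldrop i (psnd (psnd c)) = 0 \<longleftrightarrow> ldrop i ys = 0) \<and>
        (ldrop i ys \<noteq> 0 \<longrightarrow> lmem (judg (lhd (ldrop i (psnd (psnd c)))) a (lhd (ldrop i ys))) l))) \<or>
    pfst c = 5 \<and> a \<noteq> 0 \<and> lhd a = 0 \<and> lmem (judg (pfst (psnd c)) (ltl a) v) l \<or>
    pfst c = 5 \<and> a \<noteq> 0 \<and> lhd a \<noteq> 0 \<and>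
      (\<exists>r<l. lmem (judg c (lcons (lhd a - 1) (ltl a)) r) l \<and>
        lmem (judg (psnd (psnd c)) (lcons (lhd a - 1) (lcons r (ltl a))) v) l) \<or>
    pfst c = 6 \<and> lmem (judg (psnd c) (lcons v a) 0) l \<and>
      (\<forall>m<v. \<exists>y<l. 0 < y \<and> lmem (judg (psnd c) (lcons m a) y) l)"

definition derivation :: "nat \<Rightarrow> bool" where
  "derivation l \<longleftrightarrow> (\<forall>i<l. ldrop i l \<noteq> 0 \<longrightarrow>
    justified (pfst (lhd (ldrop i l))) (pfst (psnd (lhd (ldrop i l)))) (psnd (psnd (lhd (ldrop i l))))
      (ltl (ldrop i l)))"

lemma cdec_justified [crec_intros]:
  assumes c: "crec b X c" and a: "crec b X a" and v: "crec b X v" and l: "crec b X l"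
  shows "cdec b X (\<lambda>x. justified (c x) (a x) (v x) (l x))"
  unfolding justified_def
  by (intro crec_intros assms crec_comp[OF c] crec_comp[OF a] crec_comp[OF v] crec_comp[OF l])

lemma cdec_derivation [crec_intros]:
  assumes l: "crec b X l"
  shows "cdec b X (\<lambda>x. derivation (l x))"
  unfolding derivation_def by (intro crec_intros assms crec_comp[OF l])

abbreviation tri :: "recf \<Rightarrow> nat list \<Rightarrow> nat \<Rightarrow> nat" where
  "tri e xs v \<equiv> judg (enc e) (list_encode xs) v"

text \<open>The same rules on actual terms and lists, with premises in \<open>T\<close>; this
  separates the logic of evaluation from its coding.\<close>

primrec rule_instance :: "recf \<Rightarrow> nat list \<Rightarrow> nat \<Rightarrow> nat set \<Rightarrow> bool" where
  "rule_instance Zero xs v T \<longleftrightarrow> v = 0"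
| "rule_instance Succ xs v T \<longleftrightarrow> (\<exists>x. xs = [x] \<and> v = Suc x)"
| "rule_instance (Proj i) xs v T \<longleftrightarrow> i < length xs \<and> v = xs ! i"
| "rule_instance Oracle xs v T \<longleftrightarrow> False"
| "rule_instance (Comp f gs) xs v T \<longleftrightarrow>
    (\<exists>ys. length ys = length gs \<and> tri f ys v \<in> T \<and> (\<forall>i<length gs. tri (gs ! i) xs (ys ! i) \<in> T))"
| "rule_instance (PrimRec f g) xs v T \<longleftrightarrow>
    (\<exists>ys. xs = 0 # ys \<and> tri f ys v \<in> T) \<or>
    (\<exists>n ys r. xs = Suc n # ys \<and> tri (PrimRec f g) (n # ys) r \<in> T \<and> tri g (n # r # ys) v \<in> T)"
| "rule_instance (Mu f) xs v T \<longleftrightarrow>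
    tri f (v # xs) 0 \<in> T \<and> (\<forall>m<v. \<exists>y>0. tri f (m # xs) y \<in> T)"

lemma list_encode_surj: "\<exists>xs. n = list_encode xs"
  using list_decode_inverse[of n] by metis

lemma judg_mem_less:
  assumes "judg c a v \<in> set ts" shows "a < list_encode ts" "v < list_encode ts"
  using mem_less_list_encode[OF assms] le_pair_right[of "pair a v" c] le_pair_left[of a v]
    le_pair_right[of v a]
  by (simp_all add: judg_def)

text \<open>The bounded quantifiers of \<open>justified\<close> lose nothing, because arguments and
  results of listed judgments are smaller than the code of the list.\<close>

lemma justified_enc:
  "justified (enc e) (list_encode xs) v (list_encode ts) \<longleftrightarrow> rule_instance e xs v (set ts)"
proof (cases e)
  case Succ
  have "list_encode xs = lcons (lhd (list_encode xs)) 0 \<and> v = Suc (lhd (list_encode xs)) \<longleftrightarrow>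
      (\<exists>x. xs = [x] \<and> v = Suc x)"
    by (cases xs) auto
  then show ?thesis using Succ by (simp add: justified_def)
next
  case (Proj i)
  have "drop i xs \<noteq> [] \<and> v = lhd (list_encode (drop i xs)) \<longleftrightarrow> i < length xs \<and> v = xs ! i"
    by (cases "i < length xs") (auto simp flip: Cons_nth_drop_Suc)
  then show ?thesis using Proj by (simp add: justified_def)
next
  case (Comp f gs)
  define Q where "Q l \<longleftrightarrow> (\<forall>i<list_encode (map enc gs) + l.
      (ldrop i (list_encode (map enc gs)) = 0 \<longleftrightarrow> ldrop i l = 0) \<and>
      (ldrop i l \<noteq> 0 \<longrightarrow> lmem (judg (lhd (ldrop i (list_encode (map enc gs)))) (list_encode xs)
        (lhd (ldrop i l))) (list_encode ts)))" for l
  have "(\<forall>i<list_encode (map enc gs) + list_encode ys.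
        (length gs \<le> i \<longleftrightarrow> length ys \<le> i) \<and>
        (\<not> length ys \<le> i \<longrightarrow> judg (lhd (list_encode (drop i (map enc gs)))) (list_encode xs)
          (lhd (list_encode (drop i ys))) \<in> set ts)) \<longleftrightarrow>
      length ys = length gs \<and> (\<forall>i<length gs. tri (gs ! i) xs (ys ! i) \<in> set ts)"
    (is "(\<forall>i<?m. ?P i) \<longleftrightarrow> ?Q") for ys
  proof
    have m: "length gs \<le> ?m" "length ys \<le> ?m"
      using length_le_list_encode[of "map enc gs"] length_le_list_encode[of ys] by auto
    have hd: "judg (lhd (list_encode (drop i (map enc gs)))) (list_encode xs)
          (lhd (list_encode (drop i ys))) = tri (gs ! i) xs (ys ! i)"
      if "i < length gs" "i < length ys" for i
      using that by (simp flip: Cons_nth_drop_Suc)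
    show ?Q if P: "\<forall>i<?m. ?P i"
    proof -
      have iff: "length gs \<le> i \<longleftrightarrow> length ys \<le> i" if "i < ?m" for i
        using P that by blast
      \<comment> \<open>If the lengths differed, the equivalence would fail at the smaller one,
        which lies below the bound.\<close>
      have "\<not> length gs < length ys" "\<not> length ys < length gs"
        using iff[of "length gs"] iff[of "length ys"] m by linarith+
      then have len: "length gs = length ys" by linarith
      have "tri (gs ! i) xs (ys ! i) \<in> set ts" if i: "i < length gs" for i
      proof -
        have "?P i" using P i m(1) by auto
        then show ?thesis using hd[of i] i len by simp
      qed
      with len show ?thesis by simp
    qed
    show "\<forall>i<?m. ?P i" if ?Q
      using that hd by (simp add: not_le)
  qed
  then have Q: "Q (list_encode ys) \<longleftrightarrow>
      length ys = length gs \<and> (\<forall>i<length gs. tri (gs ! i) xs (ys ! i) \<in> set ts)" for ys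
    by (simp add: Q_def)
  have "justified (enc e) (list_encode xs) v (list_encode ts) \<longleftrightarrow>
      (\<exists>l<list_encode ts. judg (enc f) l v \<in> set ts \<and> Q l)"
    by (simp add: Comp justified_def Q_def)
  also have "\<dots> \<longleftrightarrow> (\<exists>ys. tri f ys v \<in> set ts \<and> Q (list_encode ys))"
    using list_encode_surj judg_mem_less(1) by metis
  also have "\<dots> \<longleftrightarrow> rule_instance e xs v (set ts)"
    unfolding Q using Comp by auto
  finally show ?thesis .
next
  case (PrimRec f g)
  show ?thesis
  proof (cases xs)
    case Nil
    then show ?thesis using PrimRec by (simp add: justified_def)
  next
    case (Cons n ys)
    then show ?thesis using PrimRec
      by (cases n) (auto simp: justified_def, blast dest: judg_mem_less(2))
  qed
next
  case (Mu f)
  then show ?thesis using judg_mem_less(2) by (fastforce simp: justified_def)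
qed (simp_all add: justified_def)

section \<open>Soundness and completeness of derivations\<close>

lemma derivation_0 [simp]: "derivation 0"
  by (simp add: derivation_def)

lemma derivation_Cons:
  "derivation (list_encode (t # ts)) \<longleftrightarrow>
    justified (pfst t) (pfst (psnd t)) (psnd (psnd t)) (list_encode ts) \<and> derivation (list_encode ts)"
proof -
  \<comment> \<open>\<open>P us\<close> says that the head of \<open>us\<close> is justified by its
    tail. A derivation satisfies it at every suffix, the empty one trivially.\<close>
  define P where "P us = (us \<noteq> [] \<longrightarrow>
    justified (pfst (hd us)) (pfst (psnd (hd us))) (psnd (psnd (hd us))) (list_encode (tl us)))" for us
  have P_eq: "(ldrop i (list_encode us) \<noteq> 0 \<longrightarrow>
      justified (pfst (lhd (ldrop i (list_encode us)))) (pfst (psnd (lhd (ldrop i (list_encode us)))))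
        (psnd (psnd (lhd (ldrop i (list_encode us))))) (ltl (ldrop i (list_encode us)))) \<longleftrightarrow>
      P (drop i us)" for i us
    by (cases "drop i us") (auto simp: P_def)
  have der: "derivation (list_encode us) \<longleftrightarrow> (\<forall>i. P (drop i us))" for us
  proof -
    have "derivation (list_encode us) \<longleftrightarrow> (\<forall>i<list_encode us. P (drop i us))"
      unfolding derivation_def P_eq by (rule refl)
    moreover have "P (drop i us)" if "\<not> i < list_encode us" for i
      using that length_le_list_encode[of us] by (simp add: P_def)
    ultimately show ?thesis by blast
  qed
  have "(\<forall>i. P (drop i (t # ts))) \<longleftrightarrow> P (t # ts) \<and> (\<forall>i. P (drop i ts))"
    by (metis drop0 drop_Suc_Cons not0_implies_Suc)
  then show ?thesis unfolding der by (simp add: P_def)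
qed

lemma rule_instance_mono: "rule_instance e xs v S \<Longrightarrow> S \<subseteq> T \<Longrightarrow> rule_instance e xs v T"
  by (cases e) (auto; blast)+

text \<open>The premises of the head lie in the tail, where the induction hypothesis applies. The
  oracle is arbitrary, as no rule consults it.\<close>

lemma derivation_sound:
  "derivation (list_encode ts) \<Longrightarrow> tri e xs v \<in> set ts \<Longrightarrow> eval X e xs v"
proof (induction ts arbitrary: e xs v)
  case (Cons t ts)
  from Cons.prems(1) have d: "derivation (list_encode ts)"
    and t: "justified (pfst t) (pfst (psnd t)) (psnd (psnd t)) (list_encode ts)"
    unfolding derivation_Cons by auto
  note IH = Cons.IH[OF d]
  show ?case
  proof (cases "tri e xs v \<in> set ts")
    case False
    with Cons.prems(2) have "t = tri e xs v" by auto
    with t have "rule_instance e xs v (set ts)"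
      by (simp add: judg_def justified_enc)
    then show ?thesis
    proof (cases e)
      case (Comp f gs)
      with \<open>rule_instance e xs v (set ts)\<close> obtain ys where
        "length ys = length gs" "tri f ys v \<in> set ts" "\<forall>i<length gs. tri (gs ! i) xs (ys ! i) \<in> set ts"
        by auto
      then show ?thesis unfolding Comp
        by (intro eval.Comp[of _ _ _ ys]) (auto simp: list_all2_conv_all_nth IH)
    next
      case (PrimRec f g)
      with \<open>rule_instance e xs v (set ts)\<close> consider
        ys where "xs = 0 # ys" "tri f ys v \<in> set ts"
        | n ys r where "xs = Suc n # ys" "tri e (n # ys) r \<in> set ts" "tri g (n # r # ys) v \<in> set ts"
        by auto
      then show ?thesis
        by cases (auto simp: PrimRec simp del: list_encode_lcons enc.simps intro: eval.intros dest!: IH)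
    next
      case (Mu f)
      with \<open>rule_instance e xs v (set ts)\<close> have
        "tri f (v # xs) 0 \<in> set ts" "\<forall>m<v. \<exists>y>0. tri f (m # xs) y \<in> set ts"
        by auto
      then show ?thesis unfolding Mu by (intro eval.Mu) (blast dest: IH)+
    qed (auto intro: eval.intros)
  qed (rule IH)
qed simp

text \<open>Argued on codes, since \<open>c\<close> may code no term at all. Enlarging the list
  keeps all premises, and a witness stays below the new bound because it occurs in a listed
  judgment.\<close>

lemma justified_mono:
  assumes sub: "set ts \<subseteq> set us" and just: "justified c a v (list_encode ts)"
  shows "justified c a v (list_encode us)"
proof -
  have mem: "lmem t (list_encode us)" if "lmem t (list_encode ts)" for t
    using that sub by auto
  have ex: "\<exists>y<list_encode us. lmem (J y) (list_encode us) \<and> P' y"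
    if "\<exists>y<list_encode ts. lmem (J y) (list_encode ts) \<and> P y" "\<And>y. P y \<Longrightarrow> P' y"
      "\<And>y. lmem (J y) (list_encode us) \<Longrightarrow> y < list_encode us" for J P P'
    using that mem by blast
  have less: "lmem (judg c a v) (list_encode us) \<Longrightarrow> a < list_encode us"
    "lmem (judg c a v) (list_encode us) \<Longrightarrow> v < list_encode us" for c a v
    using judg_mem_less by auto
  have "(\<exists>y<list_encode us. 0 < y \<and> lmem (judg c a y) (list_encode us))"
    if "(\<exists>y<list_encode ts. 0 < y \<and> lmem (judg c a y) (list_encode ts))" for c a
    using that mem less(2) by blast
  then show ?thesis
    using just unfolding justified_def
    by (elim disj_forward conj_forward) (assumption | erule ex mem all_forward imp_forward | blast intro: less mem)+
qed

lemma derivation_append: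
  "derivation (list_encode ts) \<Longrightarrow> derivation (list_encode us) \<Longrightarrow> derivation (list_encode (ts @ us))"
proof (induction ts)
  case (Cons t ts)
  then show ?case
    using justified_mono[of ts "ts @ us"] unfolding append_Cons derivation_Cons by auto
qed simp

definition derivable :: "nat \<Rightarrow> bool" where
  "derivable t \<longleftrightarrow> (\<exists>ts. derivation (list_encode ts) \<and> t \<in> set ts)"

text \<open>Concatenating derivations gathers all premises of a rule in one list.\<close>

lemma derivable_finite:
  assumes "finite T" "\<And>t. t \<in> T \<Longrightarrow> derivable t"
  shows "\<exists>ts. derivation (list_encode ts) \<and> T \<subseteq> set ts"
  using assms
proof (induction T)
  case empty
  then show ?case by (intro exI[of _ "[]"]) simp
next
  case (insert t T)
  then obtain ts where "derivation (list_encode ts)" "T \<subseteq> set ts" by blast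
  moreover obtain us where "derivation (list_encode us)" "t \<in> set us"
    using insert.prems unfolding derivable_def by blast
  ultimately show ?case by (intro exI[of _ "ts @ us"]) (auto intro: derivation_append)
qed

lemma derivable_rule:
  assumes "finite T" "\<And>t. t \<in> T \<Longrightarrow> derivable t" "rule_instance e xs v T"
  shows "derivable (tri e xs v)"
proof -
  obtain ts where ts: "derivation (list_encode ts)" "T \<subseteq> set ts"
    using derivable_finite[OF assms(1,2)] by blast
  have "justified (enc e) (list_encode xs) v (list_encode ts)"
    unfolding justified_enc using rule_instance_mono[OF assms(3) ts(2)] .
  then have "derivation (list_encode (tri e xs v # ts))"
    unfolding derivation_Cons using ts(1) by (simp add: judg_def)
  then show ?thesis unfolding derivable_def by (intro exI[of _ "tri e xs v # ts"]) simp
qed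

text \<open>Each evaluation rule has finitely many premises: one per component for
  \<open>Comp\<close>, and one per tested value up to the result for \<open>Mu\<close>.\<close>

lemma derivation_complete:
  "eval X e xs v \<Longrightarrow> oracle_free e \<Longrightarrow> derivable (tri e xs v)"
proof (induction rule: eval.induct)
  case (Comp xs gs ys f z)
  have len: "length gs = length ys" using Comp.IH(1) by (rule list_all2_lengthD)
  have "derivable (tri (gs ! i) xs (ys ! i))" if "i < length gs" for i
    using list_all2_nthD[OF Comp.IH(1) that] Comp.prems that by (auto simp: list_all_length)
  with len Comp show ?case
    by (intro derivable_rule[of "insert (tri f ys z) ((\<lambda>i. tri (gs ! i) xs (ys ! i)) ` {..<length gs})"])
      (auto intro!: exI[of _ ys])
next
  case (PrimRec_0 f xs y g)
  then show ?case by (intro derivable_rule[of "{tri f xs y}"]) auto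
next
  case (PrimRec_Suc f g n xs r y)
  then show ?case
    by (intro derivable_rule[of "{tri (PrimRec f g) (n # xs) r, tri g (n # r # xs) y}"]) auto
next
  case (Mu f n xs)
  then obtain Y where Y: "\<And>m. m < n \<Longrightarrow> derivable (tri f (m # xs) (Y m)) \<and> Y m > 0"
    using oracle_free.simps(7) by metis
  with Mu show ?case
    by (intro derivable_rule[of "insert (tri f (n # xs) 0) ((\<lambda>m. tri f (m # xs) (Y m)) ` {..<n})"]) auto
qed (auto intro!: derivable_rule[of "{}"] simp del: list_encode_lcons enc.simps)

text \<open>Allows a chosen judgment to be brought to the head of a derivation.\<close>

lemma derivation_drop: "derivation (list_encode ts) \<Longrightarrow> derivation (list_encode (drop n ts))"
proof (induction n arbitrary: ts)
  case (Suc n)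
  then show ?case by (cases ts) (auto simp: derivation_Cons simp del: list_encode_lcons)
qed simp

section \<open>Observing unary programs in stages\<close>

definition hit_arg :: "nat \<Rightarrow> nat" where "hit_arg d = lhd (pfst (psnd (lhd d)))"
definition hit_res :: "nat \<Rightarrow> nat" where "hit_res d = psnd (psnd (lhd d))"
text \<open>The stage \<open>d\<close> is itself the code of a derivation, whose head reports a
  result of program \<open>e\<close> on a one-element argument list. Hence convergence at a stage is
  decidable.\<close>

definition hit :: "nat \<Rightarrow> nat \<Rightarrow> bool" where
  "hit e d \<longleftrightarrow> derivation d \<and> d \<noteq> 0 \<and> pfst (lhd d) = e \<and> pfst (psnd (lhd d)) = lcons (hit_arg d) 0"

lemma hit_sound:
  assumes "hit (enc e) d"
  shows "eval X e [hit_arg d] (hit_res d)"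
proof -
  obtain ts where ts: "d = list_encode ts" using list_encode_surj by blast
  with assms obtain t us where us: "ts = t # us" by (cases ts) (auto simp: hit_def)
  have "t = tri e [hit_arg d] (hit_res d)"
    using assms unfolding hit_def hit_res_def judg_def by (simp add: ts us) (metis pair_pfst_psnd)
  then show ?thesis
    using derivation_sound[of ts e "[hit_arg d]" "hit_res d" X] assms ts us by (auto simp: hit_def)
qed

lemma hit_complete:
  assumes "eval X e [n] v" "oracle_free e"
  shows "\<exists>d. hit (enc e) d \<and> hit_arg d = n \<and> hit_res d = v"
proof -
  obtain ts where ts: "derivation (list_encode ts)" "tri e [n] v \<in> set ts"
    using derivation_complete[OF assms] unfolding derivable_def by blast
  then obtain us vs where "ts = us @ tri e [n] v # vs" by (meson split_list)
  with derivation_drop[OF ts(1), of "length us"] have "derivation (list_encode (tri e [n] v # vs))"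
    by simp
  then show ?thesis
    by (intro exI[of _ "list_encode (tri e [n] v # vs)"])
      (simp add: hit_def hit_arg_def hit_res_def judg_def)
qed

text \<open>
  The value \<open>Suc (pair n v)\<close> of \<open>latest e s\<close> records the largest argument \<open>n\<close> at which program \<open>e\<close>
  is seen to converge by stage \<open>s\<close>, and its result \<open>v\<close>.
\<close>

definition latest :: "nat \<Rightarrow> nat \<Rightarrow> nat" where
  "latest e s = rec_nat 0 (\<lambda>d r. if hit e d \<and> (r = 0 \<or> pfst (r - 1) \<le> hit_arg d)
    then Suc (pair (hit_arg d) (hit_res d)) else r) s"

lemma latest_0 [simp]: "latest e 0 = 0"
  and latest_Suc: "latest e (Suc s) =
    (if hit e s \<and> (latest e s = 0 \<or> pfst (latest e s - 1) \<le> hit_arg s)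
     then Suc (pair (hit_arg s) (hit_res s)) else latest e s)"
  by (simp_all only: latest_def old.nat.rec)

lemma crec_latest [crec_intros]:
  assumes e: "crec b X e" and s: "crec b X s"
  shows "crec b X (\<lambda>x. latest (e x) (s x))"
  unfolding latest_def hit_def hit_arg_def hit_res_def
  by (intro crec_intros assms crec_comp[OF e] crec_comp[OF s])

text \<open>Every recorded result comes from a sound derivation, and evaluation is
  deterministic.\<close>

lemma latest_sound:
  assumes "\<And>n. eval X e [n] (f n)" "latest (enc e) s \<noteq> 0"
  shows "\<exists>n. latest (enc e) s = Suc (pair n (f n))"
  using assms(2)
proof (induction s)
  case (Suc s)
  have "hit_res s = f (hit_arg s)" if "hit (enc e) s"
    using hit_sound[OF that] assms(1) by (rule eval_deterministic)
  with Suc show ?case by (auto simp: latest_Suc)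
qed simp

lemma latest_ge: "hit e d \<Longrightarrow> d < s \<Longrightarrow> latest e s \<noteq> 0 \<and> hit_arg d \<le> pfst (latest e s - 1)"
  by (induction s) (auto simp: latest_Suc less_Suc_eq)

text \<open>Once a derivation of the value at \<open>N\<close> has appeared, the recorded argument
  never drops below \<open>N\<close>; the recorded value thus lies in any prescribed tail of
  \<open>f\<close>.\<close>

lemma latest_eventually:
  assumes "\<And>n. eval X e [n] (f n)" "oracle_free e"
  shows "\<exists>s0. \<forall>s\<ge>s0. \<exists>n\<ge>N. latest (enc e) s = Suc (pair n (f n))"
proof -
  obtain d where d: "hit (enc e) d" "hit_arg d = N"
    using hit_complete[OF assms(1)[of N] assms(2)] by blast
  have "\<exists>n\<ge>N. latest (enc e) s = Suc (pair n (f n))" if "s \<ge> Suc d" for s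
    using latest_ge[OF d(1), of s] latest_sound[of X e f s] assms(1) d(2) that by fastforce
  then show ?thesis by blast
qed

section \<open>The linear order\<close>

text \<open>
  The number \<open>pair s i\<close> with \<open>i < 2 ^ s\<close> stands for the dyadic rational \<open>i / 2 ^ s\<close>; different
  representations of a rational are ordered by their level \<open>s\<close>. The dyadic interval of level \<open>m\<close>
  containing this rational has number \<^term>\<open>cell m (pair s i)\<close>.
\<close>

definition cell :: "nat \<Rightarrow> nat \<Rightarrow> nat" where
  "cell m x = psnd x * 2 ^ m div 2 ^ pfst x"

text \<open>Membership is decided at the level of the element itself. The range of \<open>e\<close>
  means \<open>e + 2 \<le> pfst x\<close>, so the forbidden intervals are no finer than the level of
  \<open>x\<close>. A program not yet seen to converge forbids nothing.\<close>

definition node :: "nat \<Rightarrow> bool" where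
  "node x \<longleftrightarrow> psnd x < 2 ^ pfst x \<and> (\<forall>e<pfst x - 1. latest e (pfst x) = 0 \<or>
    cell (e + 2) x \<noteq> cell (e + 2) (psnd (latest e (pfst x) - 1)))"

text \<open>Cross multiplication compares the rationals within the naturals, so decidability is
  immediate.\<close>

definition dle :: "nat \<Rightarrow> nat \<Rightarrow> bool" where
  "dle x y \<longleftrightarrow> psnd x * 2 ^ pfst y < psnd y * 2 ^ pfst x \<or>
    psnd x * 2 ^ pfst y = psnd y * 2 ^ pfst x \<and> pfst x \<le> pfst y"

definition dyadic :: "nat \<Rightarrow> real" where
  "dyadic x = real (psnd x) / 2 ^ pfst x"

lemma dle_iff: "dle x y \<longleftrightarrow> dyadic x < dyadic y \<or> dyadic x = dyadic y \<and> pfst x \<le> pfst y"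
proof -
  have "dyadic x < dyadic y \<longleftrightarrow> real (psnd x * 2 ^ pfst y) < real (psnd y * 2 ^ pfst x)"
    "dyadic x = dyadic y \<longleftrightarrow> real (psnd x * 2 ^ pfst y) = real (psnd y * 2 ^ pfst x)"
    by (simp_all add: dyadic_def field_simps)
  then show ?thesis unfolding dle_def of_nat_less_iff of_nat_eq_iff by blast
qed

lemma dle_refl: "dle x x"
  and dle_total: "dle x y \<or> dle y x"
  and dle_trans: "dle x y \<Longrightarrow> dle y z \<Longrightarrow> dle x z"
  by (auto simp: dle_iff)

lemma dle_antisym:
  assumes "dle x y" "dle y x"
  shows "x = y"
proof -
  have "dyadic x = dyadic y" "pfst x = pfst y" using assms by (auto simp: dle_iff)
  then have "psnd x = psnd y" by (simp add: dyadic_def)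
  with \<open>pfst x = pfst y\<close> show ?thesis using pair_pfst_psnd by metis
qed

text \<open>The cell number is the floor of \<open>dyadic x * 2 ^ m\<close>, and floor is
  monotone.\<close>

lemma cell_mono:
  assumes "dle x y"
  shows "cell m x \<le> cell m y"
proof -
  have "int (cell m x) = \<lfloor>dyadic x * 2 ^ m\<rfloor>" for x
    using floor_divide_of_nat_eq[of "psnd x * 2 ^ m" "2 ^ pfst x", where 'a = real]
    by (simp add: cell_def dyadic_def)
  moreover have "\<lfloor>dyadic x * 2 ^ m\<rfloor> \<le> \<lfloor>dyadic y * 2 ^ m\<rfloor>"
    using assms by (intro floor_mono mult_right_mono) (auto simp: dle_iff)
  ultimately show ?thesis by (metis of_nat_le_iff)
qed

lemma cell_less: "node x \<Longrightarrow> cell m x < 2 ^ m"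
  unfolding cell_def node_def by (auto intro!: less_mult_imp_div_less)

lemma crec_cell [crec_intros]: "crec b X f \<Longrightarrow> crec b X g \<Longrightarrow> crec b X (\<lambda>x. cell (f x) (g x))"
  unfolding cell_def by (intro crec_intros)

lemma cdec_node [crec_intros]:
  assumes f: "crec b X f"
  shows "cdec b X (\<lambda>x. node (f x))"
  unfolding node_def by (intro crec_intros f crec_comp[OF f])

lemma cdec_dle [crec_intros]: "crec b X f \<Longrightarrow> crec b X g \<Longrightarrow> cdec b X (\<lambda>x. dle (f x) (g x))"
  unfolding dle_def by (intro crec_intros)

section \<open>Sequences whose cells settle\<close>

lemma incseq_nat_bounded_eventually_const:
  fixes g :: "nat \<Rightarrow> nat"
  assumes "incseq g" "\<And>n. g n < K"
  shows "\<exists>c N. \<forall>n\<ge>N. g n = c"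
proof -
  have "finite (range g)" using assms(2) by (meson finite_lessThan finite_subset image_subsetI lessThan_iff)
  then obtain N where "g N = Max (range g)" using Max_in[of "range g"] by fastforce
  then have "g n = g N" if "n \<ge> N" for n
    using Max_ge[OF \<open>finite (range g)\<close>, of "g n"] incseqD[OF assms(1) that] by simp
  then show ?thesis by blast
qed

lemma decseq_nat_eventually_const:
  fixes g :: "nat \<Rightarrow> nat"
  assumes "decseq g"
  shows "\<exists>c N. \<forall>n\<ge>N. g n = c"
proof -
  obtain N where "g N = (LEAST y. y \<in> range g)" using LeastI[of "\<lambda>y. y \<in> range g" "g 0"] by auto
  then have "g n = g N" if "n \<ge> N" for n
    using decseqD[OF assms that] by (simp add: Least_le order_antisym)
  then show ?thesis by blast
qed

text \<open>
  Program \<open>e\<close> eventually forbids new nodes in the cell of level \<open>e + 2\<close> where its values settle.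
\<close>

lemma not_computable_if_cells_converge:
  assumes "inj f" "\<And>n. node (f n)" and conv: "\<And>m. \<exists>c N. \<forall>n\<ge>N. cell m (f n) = c"
  shows "\<not> computable f"
proof
  assume "computable f"
  then obtain e where e: "oracle_free e" "\<And>n. eval (\<lambda>_. False) e [n] (f n)"
    unfolding computable_def by blast
  obtain c N where N: "\<And>n. n \<ge> N \<Longrightarrow> cell (enc e + 2) (f n) = c"
    using conv by blast
  obtain s0 where s0: "\<And>s. s \<ge> s0 \<Longrightarrow> \<exists>n\<ge>N. latest (enc e) s = Suc (pair n (f n))"
    using latest_eventually[OF e(2,1)] by blast
  \<comment> \<open>From level \<open>K\<close> on, the program already records a value in the
    settled tail and is among those allowed to forbid, as
    \<open>enc e < pfst (f n) - 1\<close>.\<close>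
  define K where "K = s0 + enc e + 2"
  have "pfst (f n) < K" if "n \<ge> N" for n
  proof (rule ccontr)
    assume "\<not> pfst (f n) < K"
    then have K: "s0 \<le> pfst (f n)" "enc e < pfst (f n) - 1" by (auto simp: K_def)
    from s0[OF K(1)] obtain n' where n': "n' \<ge> N" "latest (enc e) (pfst (f n)) = Suc (pair n' (f n'))"
      by blast
    with K(2) assms(2)[of n] have "cell (enc e + 2) (f n) \<noteq> cell (enc e + 2) (f n')"
      by (auto simp: node_def)
    with N[OF that] N[OF n'(1)] show False by simp
  qed
  \<comment> \<open>Only finitely many nodes have level below \<open>K\<close>, which contradicts
    injectivity on the tail.\<close>
  then have "f ` {N..} \<subseteq> (\<lambda>(s, i). pair s i) ` (SIGMA s:{..<K}. {..<2 ^ s})"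
    using assms(2) by (auto simp: node_def intro!: rev_image_eqI[of "(pfst y, psnd y)" for y])
  then have "finite (f ` {N..})" by (rule finite_subset) auto
  then show False
    using finite_imageD[of f "{N..}"] assms(1) infinite_Ici by (auto intro: inj_on_subset)
qed

section \<open>Truncations of an oracle\<close>

primrec prefix_num :: "(nat \<Rightarrow> bool) \<Rightarrow> nat \<Rightarrow> nat" where
  "prefix_num X 0 = 0"
| "prefix_num X (Suc s) = 2 * prefix_num X s + of_bool (X s)"

text \<open>The truncation of the binary real \<open>0.X(0)X(1)...\<close> to its first
  \<open>s\<close> digits.\<close>

definition path :: "(nat \<Rightarrow> bool) \<Rightarrow> nat \<Rightarrow> nat" where "path X s = pair s (prefix_num X s)"

lemma prefix_num_less: "prefix_num X s < 2 ^ s"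
  by (induction s) auto

lemma pfst_path [simp]: "pfst (path X s) = s"
  by (simp add: path_def)

lemma dle_path: "s \<le> t \<Longrightarrow> dle (path X s) (path X t)"
proof (induction t rule: dec_induct)
  case (step t)
  have "dle (path X t) (path X (Suc t))" by (cases "X t") (auto simp: dle_def path_def)
  with step.IH show ?case by (rule dle_trans)
qed (rule dle_refl)

text \<open>Each division by 2 strips the last digit, so the cell of level \<open>m\<close> retains
  exactly the first \<open>m\<close> digits.\<close>

lemma cell_path: "m \<le> s \<Longrightarrow> cell m (path X s) = prefix_num X m"
proof (induction s rule: dec_induct)
  case (step s)
  have "cell m (path X (Suc s)) = prefix_num X (Suc s) div 2 div (2 ^ (s - m))"
    using step.hyps power_add[of "2::nat" m "Suc s - m"]
    by (simp add: cell_def path_def div_mult2_eq[symmetric] Suc_diff_le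
        del: prefix_num.simps)
  also have "\<dots> = cell m (path X s)"
    using step.hyps power_add[of "2::nat" m "s - m"] by (simp add: cell_def path_def)
  finally show ?case using step.IH by simp
qed (simp add: cell_def path_def)

lemma crec_path [crec_intros]: "crec True X f \<Longrightarrow> crec True X (\<lambda>x. path X (f x))"
proof -
  assume f: "crec True X f"
  have "crec True X (\<lambda>x. rec_nat 0 (\<lambda>i r. 2 * r + of_bool (X i)) (f x))"
    by (intro crec_intros crec_oracle f)
  moreover have "rec_nat 0 (\<lambda>i r. 2 * r + of_bool (X i)) s = prefix_num X s" for s
    by (induction s) auto
  ultimately show ?thesis unfolding path_def by (intro crec_intros f) simp
qed

section \<open>Random oracles\<close>

lemma prob_space_cantor: "prob_space cantor_measure"
  unfolding cantor_measure_def by (intro prob_space_PiM) (rule measure_pmf.prob_space_axioms)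

interpretation cantor: prob_space cantor_measure
  by (rule prob_space_cantor)

lemma space_cantor [simp]: "space cantor_measure = UNIV"
  by (simp add: cantor_measure_def space_PiM)

lemma events_CollectI: "Measurable.pred cantor_measure P \<Longrightarrow> {X. P X} \<in> cantor.events"
  by (simp add: pred_def)

lemma measurable_bit [measurable]: "(\<lambda>X. X i) \<in> cantor_measure \<rightarrow>\<^sub>M count_space UNIV"
proof -
  have "(\<lambda>X. X i) \<in> cantor_measure \<rightarrow>\<^sub>M measure_pmf (bernoulli_pmf (1 / 2))"
    unfolding cantor_measure_def by (rule measurable_component_singleton) simp
  also have "cantor_measure \<rightarrow>\<^sub>M measure_pmf (bernoulli_pmf (1 / 2)) =
      cantor_measure \<rightarrow>\<^sub>M count_space UNIV"
    by (rule measurable_cong_sets) simp_all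
  finally show ?thesis .
qed

lemma prob_cylinder: "cantor.prob {X. \<forall>i<m. X i = B i} = (1 / 2) ^ m"
proof -
  let ?M = "\<lambda>_ :: nat. measure_pmf (bernoulli_pmf (1 / 2))"
  interpret product_prob_space ?M UNIV ..
  have "prod_emb UNIV ?M {..<m} (PiE {..<m} (\<lambda>i. {B i})) = {X. \<forall>i<m. X i = B i}"
    by (subst prod_emb_PiE) (auto simp: PiE_UNIV_domain split: if_splits)
  moreover have "measure (PiM UNIV ?M) (prod_emb UNIV ?M {..<m} (PiE {..<m} (\<lambda>i. {B i}))) =
      (\<Prod>i<m. measure (measure_pmf (bernoulli_pmf (1 / 2))) {B i})"
    by (rule measure_PiM_emb) auto
  moreover have "measure (measure_pmf (bernoulli_pmf (1 / 2))) {b} = 1 / 2" for b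
    by (cases b) (simp_all add: measure_pmf_single)
  ultimately show ?thesis by (simp add: cantor_measure_def)
qed

section \<open>The probability that a truncation is forbidden\<close>

lemma measurable_prefix_num [measurable]:
  "(\<lambda>X. prefix_num X m) \<in> cantor_measure \<rightarrow>\<^sub>M count_space UNIV"
proof (induction m)
  case (Suc m)
  note [measurable] = Suc
  show ?case unfolding prefix_num.simps by measurable
qed simp

lemma prefix_num_eq_iff: "prefix_num X m = prefix_num Y m \<longleftrightarrow> (\<forall>i<m. X i = Y i)"
proof (induction m)
  case (Suc m)
  have "2 * a + of_bool p = 2 * c + of_bool q \<longleftrightarrow> a = c \<and> p = q" for a c :: nat and p q
    by (cases p; cases q; simp; presburger)
  then show ?case using Suc by (auto simp: less_Suc_eq)
qed simp

text \<open>At most one word of \<open>m\<close> bits has the value \<open>c\<close>, so the event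
  is a cylinder or empty.\<close>

lemma prob_prefix_num_le: "cantor.prob {X. prefix_num X m = c} \<le> (1 / 2) ^ m"
proof (cases "\<exists>B. prefix_num B m = c")
  case True
  then obtain B where B: "prefix_num B m = c" by blast
  have "{X. prefix_num X m = c} = {X. \<forall>i<m. X i = B i}"
    unfolding B[symmetric] prefix_num_eq_iff ..
  with prob_cylinder[of m B] show ?thesis by (metis order_refl)
next
  case False
  then have "{X. prefix_num X m = c} = {}" by blast
  then show ?thesis by (metis measure_empty zero_le_power zero_le_divide_1_iff zero_le_numeral)
qed

lemma measurable_node_path [measurable]: "Measurable.pred cantor_measure (\<lambda>X. node (path X s))"
  unfolding path_def by measurable

lemma prob_not_node_le: "cantor.prob {X. \<not> node (path X s)} \<le> 1 / 2"
proof -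
  \<comment> \<open>The forbidden cell depends only on \<open>e\<close> and \<open>s\<close>, never
    on the oracle, so \<open>E e\<close> is a fixed event. If \<open>latest e s = 0\<close>,
    including \<open>E e\<close> merely enlarges the union bound.\<close>
  define c where "c e = cell (e + 2) (psnd (latest e s - 1))" for e
  define E where "E e = {X. prefix_num X (e + 2) = c e}" for e
  have E: "E e \<in> cantor.events" for e
    unfolding E_def by (rule events_CollectI) measurable
  have "{X. \<not> node (path X s)} \<subseteq> (\<Union>e<s - 1. E e)"
  proof
    fix X assume "X \<in> {X. \<not> node (path X s)}"
    then obtain e where e: "e < s - 1" "cell (e + 2) (path X s) = c e"
      using prefix_num_less[of X s] by (auto simp: node_def c_def path_def)
    from e(1) have "e + 2 \<le> s" by linarith
    with e(2) have "X \<in> E e" unfolding E_def mem_Collect_eq by (simp only: cell_path)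
    with e(1) show "X \<in> (\<Union>e<s - 1. E e)" by blast
  qed
  then have "cantor.prob {X. \<not> node (path X s)} \<le> cantor.prob (\<Union>e<s - 1. E e)"
    using E by (intro cantor.finite_measure_mono) auto
  also have "\<dots> \<le> (\<Sum>e<s - 1. cantor.prob (E e))"
    using E by (intro cantor.finite_measure_subadditive_finite) auto
  also have "\<dots> \<le> (\<Sum>e<s - 1. (1 / 2) ^ (e + 2))"
    unfolding E_def by (intro sum_mono prob_prefix_num_le)
  \<comment> \<open>The shift by 2 in the level of the forbidden cell provides the factor 1/4; the
    geometric sum stays below 2.\<close>
  also have "\<dots> = 1 / 4 * (\<Sum>e<s - 1. (1 / 2) ^ e)"
    by (simp add: sum_distrib_left)
  also have "\<dots> \<le> 1 / 2"
    by (simp add: sum_gp_strict)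
  finally show ?thesis .
qed

text \<open>The complement is the increasing union of the events that no node occurs from level
  \<open>n\<close> on. Each has probability at most 1/2, hence so does the union by continuity from
  below.\<close>

lemma prob_infinitely_many_nodes: "cantor.prob {X. infinite {s. node (path X s)}} \<ge> 1 / 2"
proof -
  define E where "E n = {X. \<forall>s\<ge>n. \<not> node (path X s)}" for n
  have sets: "E n \<in> cantor.events" for n
    unfolding E_def by (rule events_CollectI) measurable
  have "cantor.prob (E n) \<le> cantor.prob {X. \<not> node (path X n)}" for n
    unfolding E_def by (intro cantor.finite_measure_mono events_CollectI) auto
  then have "cantor.prob (E n) \<le> 1 / 2" for n
    using prob_not_node_le order_trans by blast
  moreover have "(\<lambda>n. cantor.prob (E n)) \<longlonglongrightarrow> cantor.prob (\<Union>n. E n)"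
    using sets by (intro cantor.finite_Lim_measure_incseq) (auto simp: E_def incseq_def)
  ultimately have "cantor.prob (\<Union>n. E n) \<le> 1 / 2"
    by (intro LIMSEQ_le_const2) auto
  moreover have "{X. infinite {s. node (path X s)}} = space cantor_measure - (\<Union>n. E n)"
    by (auto simp: E_def infinite_nat_iff_unbounded_le)
  ultimately show ?thesis
    using cantor.prob_compl[of "\<Union>n. E n"] sets by (simp add: sets.countable_UN)
qed

text \<open>An event of positive probability is nonempty, and the nodes on the path of one such
  oracle are distinct because their levels are.\<close>

lemma infinite_nodes: "infinite {x. node x}"
proof -
  have "cantor.prob {X. infinite {s. node (path X s)}} \<noteq> cantor.prob {}"
    using prob_infinitely_many_nodes unfolding measure_empty by linarith
  then have "{X. infinite {s. node (path X s)}} \<noteq> {}" by (rule contrapos_nn) (rule arg_cong)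
  then obtain X where X: "infinite {s. node (path X s)}" by blast
  have "inj (path X)" by (metis injI pfst_path)
  then have "infinite (path X ` {s. node (path X s)})"
    using X finite_imageD inj_on_subset by blast
  then show ?thesis by (rule infinite_super[rotated]) auto
qed

section \<open>Monotone sequences\<close>

text \<open>Transfers the order from the infinite decidable set of nodes to all naturals.\<close>

definition node_of :: "nat \<Rightarrow> nat" where "node_of = enumerate {x. node x}"

definition node_order :: "nat rel" where "node_order = {(a, c). dle (node_of a) (node_of c)}"

lemma node_node_of: "node (node_of n)"
  using enumerate_in_set[OF infinite_nodes] by (simp add: node_of_def)

lemma node_of_eq_iff: "node_of m = node_of n \<longleftrightarrow> m = n"
  unfolding node_of_def using strict_mono_enumerate[OF infinite_nodes] by (simp add: strict_mono_eq)

lemma crec_node_of: "crec b X node_of"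
  unfolding node_of_def
  using crec_enumerate[OF _ infinite_nodes] cdec_node[OF crec_id] by simp

lemma linear_order_node_order: "linear_order node_order"
  unfolding linear_order_on_def partial_order_on_def preorder_on_def node_order_def
  using dle_antisym node_of_eq_iff dle_total
  by (auto simp: refl_on_def trans_def antisym_def total_on_def dle_refl intro: dle_trans)

lemma computable_rel_node_order: "computable_rel node_order"
proof -
  let ?X = "\<lambda>_. False"
  have "cdec False ?X (\<lambda>p. dle (node_of (pfst p)) (node_of (psnd p)))"
    by (intro crec_intros crec_comp[OF crec_node_of])
  then have "rec_in False ?X 2
      (\<lambda>xs. of_bool (dle (node_of (pfst (pair (xs ! 0) (xs ! 1)))) (node_of (psnd (pair (xs ! 0) (xs ! 1))))))"
    unfolding crec_def
  proof (rule rec_in_comp1)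
    show "rec_in False ?X 2 (\<lambda>xs. pair (xs ! 0) (xs ! 1))"
      by (intro rec_in_pair rec_in_proj; simp)
  qed
  then obtain e where "oracle_free e" and
    e: "\<And>xs. length xs = 2 \<Longrightarrow> eval ?X e xs (of_bool (dle (node_of (xs ! 0)) (node_of (xs ! 1))))"
    by (auto simp: rec_in_def)
  have "eval ?X e [x, y] (of_bool ((x, y) \<in> node_order))" for x y
    using e[of "[x, y]"] by (simp add: node_order_def)
  with \<open>oracle_free e\<close> show ?thesis unfolding computable_rel_def by blast
qed

text \<open>Along a monotone sequence the cell numbers of each level are monotone. They become
  constant, in the ascending case because they stay below \<open>2 ^ m\<close>, so the sequence of
  nodes cannot be computable.\<close>

lemma no_computable_monotone_sequence:
  assumes "computable f"
  shows "\<not> ascending node_order f" "\<not> descending node_order f"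
proof -
  have comp: "computable (\<lambda>n. node_of (f n))"
    using assms crec_comp[OF crec_node_of] by (simp add: computable_iff_crec)
  show "\<not> ascending node_order f"
  proof
    assume asc: "ascending node_order f"
    have less: "dle (node_of (f m)) (node_of (f n)) \<and> f m \<noteq> f n" if "m < n" for m n
      using asc that by (auto simp: ascending_def node_order_def)
    have "inj (\<lambda>n. node_of (f n))"
      using less by (intro injI) (metis node_of_eq_iff linorder_neqE_nat)
    moreover have "\<exists>c N. \<forall>n\<ge>N. cell m (node_of (f n)) = c" for m
    proof (rule incseq_nat_bounded_eventually_const)
      show "incseq (\<lambda>n. cell m (node_of (f n)))"
        using less by (intro incseq_SucI cell_mono) auto
      show "cell m (node_of (f n)) < 2 ^ m" for n
        using node_node_of by (rule cell_less)
    qed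
    ultimately show False
      using not_computable_if_cells_converge comp node_node_of by blast
  qed
  show "\<not> descending node_order f"
  proof
    assume desc: "descending node_order f"
    have less: "dle (node_of (f n)) (node_of (f m)) \<and> f n \<noteq> f m" if "m < n" for m n
      using desc that by (auto simp: descending_def node_order_def)
    have "inj (\<lambda>n. node_of (f n))"
      using less by (intro injI) (metis node_of_eq_iff linorder_neqE_nat)
    moreover have "\<exists>c N. \<forall>n\<ge>N. cell m (node_of (f n)) = c" for m
    proof (rule decseq_nat_eventually_const)
      show "decseq (\<lambda>n. cell m (node_of (f n)))"
        using less by (intro decseq_SucI cell_mono) auto
    qed
    ultimately show False
      using not_computable_if_cells_converge comp node_node_of by blast
  qed
qed

text \<open>The oracle decides at which levels its own truncation is a node, enumerates these
  levels, and searches for the index of each node found.\<close>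

lemma computes_ascending:
  assumes inf: "infinite {s. node (path X s)}"
  shows "\<exists>f. computable_in X f \<and> ascending node_order f"
proof -
  define t where "t = enumerate {s. node (path X s)}"
  define f where "f n = (LEAST k. node_of k = path X (t n))" for n
  have t: "node (path X (t n))" "m < n \<Longrightarrow> t m < t n" for m n
    using enumerate_in_set[OF inf] enumerate_mono[OF _ inf] by (auto simp: t_def)
  have ex: "\<exists>k. node_of k = path X (t n)" for n
    using enumerate_Ex[OF infinite_nodes, of "path X (t n)"] t(1) by (simp add: node_of_def)
  have node_of_f: "node_of (f n) = path X (t n)" for n
    unfolding f_def by (rule LeastI_ex[OF ex])
  have comp_t: "crec True X t"
    unfolding t_def using inf by (intro crec_enumerate) (simp_all add: crec_intros)
  have "crec True X f"
    unfolding f_def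
  proof (rule crec_Least)
    show "cdec True X (\<lambda>p. node_of (pfst p) = path X (t (psnd p)))"
      by (intro crec_intros crec_comp[OF crec_node_of] crec_comp[OF comp_t])
  qed (rule ex)
  moreover have "ascending node_order f"
    unfolding ascending_def
  proof (intro allI impI)
    fix m n :: nat assume "m < n"
    then have lt: "t m < t n" by (rule t(2))
    then have "dle (node_of (f m)) (node_of (f n))"
      unfolding node_of_f by (intro dle_path) simp
    \<comment> \<open>Truncations may agree as rationals, but their levels differ, so the nodes
      do.\<close>
    moreover have "f m \<noteq> f n"
      using lt node_of_f pfst_path by (metis less_irrefl)
    ultimately show "(f m, f n) \<in> node_order - Id" by (simp add: node_order_def)
  qed
  ultimately show ?thesis by (auto simp: computable_in_iff_crec)
qed

section \<open>The zero-one law\<close>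

text \<open>Makes quantification over programs a countable union in the measurability proof.\<close>

instance recf :: countable
  by countable_datatype

lemma eval_Comp_iff:
  "eval X (Comp f gs) xs v \<longleftrightarrow>
    (\<exists>ys. length gs = length ys \<and> (\<forall>i<length gs. eval X (gs ! i) xs (ys ! i)) \<and> eval X f ys v)"
  by (auto elim!: eval_CompE intro!: eval.Comp simp: list_all2_conv_all_nth)

text \<open>By induction on the term: each evaluation rule is a countable Boolean combination of
  simpler evaluations.\<close>

lemma measurable_eval [measurable]: "Measurable.pred cantor_measure (\<lambda>X. eval X e xs v)"
proof (induction e arbitrary: xs v)
  case Zero
  have "eval X recf.Zero xs v \<longleftrightarrow> v = 0" for X by (auto elim: eval_ZeroE intro: eval.intros)
  then show ?case by simp
next
  case Succ
  have "eval X recf.Succ xs v \<longleftrightarrow> (\<exists>x. xs = [x] \<and> v = Suc x)" for X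
    by (auto elim: eval_SuccE intro: eval.intros)
  then show ?case by simp
next
  case (Proj i)
  have "eval X (recf.Proj i) xs v \<longleftrightarrow> i < length xs \<and> v = xs ! i" for X
    by (auto elim: eval_ProjE intro: eval.intros)
  then show ?case by simp
next
  case Oracle
  have "eval X recf.Oracle xs v \<longleftrightarrow> (\<exists>x. xs = [x] \<and> v = of_bool (X x))" for X
    by (blast elim: eval_OracleE intro: eval.Oracle)
  then show ?case by (simp only:) measurable
next
  case (Comp f gs)
  have [measurable]: "Measurable.pred cantor_measure (\<lambda>X. eval X (gs ! i) xs v)" if "i < length gs" for i xs v
    using Comp.IH(2) that by simp
  have "Measurable.pred cantor_measure (\<lambda>X. \<forall>i\<in>{..<length gs}. eval X (gs ! i) xs (ys ! i))" for ys
    by (rule pred_intros_finite) auto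
  then have [measurable]: "Measurable.pred cantor_measure (\<lambda>X. \<forall>i<length gs. eval X (gs ! i) xs (ys ! i))" for ys
    by (simp add: Ball_def)
  note [measurable] = Comp.IH(1)
  show ?case unfolding eval_Comp_iff by measurable
next
  case (PrimRec f g)
  note [measurable] = PrimRec.IH
  show ?case
  proof (cases xs)
    case Nil
    have "\<not> eval X (PrimRec f g) [] v" for X by (auto elim: eval.cases)
    with Nil show ?thesis by simp
  next
    case (Cons n ys)
    have "Measurable.pred cantor_measure (\<lambda>X. eval X (PrimRec f g) (n # ys) v)"
    \<comment> \<open>\<open>PrimRec\<close> calls itself, so structural induction must be
      supplemented by induction on the recursion argument.\<close>
    proof (induction n arbitrary: v)
      case 0
      have "eval X (PrimRec f g) (0 # ys) v \<longleftrightarrow> eval X f ys v" for X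
        by (auto elim: eval_PrimRec_0E intro: eval.intros)
      then show ?case by simp
    next
      case (Suc n)
      note [measurable] = Suc
      have "eval X (PrimRec f g) (Suc n # ys) v \<longleftrightarrow>
          (\<exists>r. eval X (PrimRec f g) (n # ys) r \<and> eval X g (n # r # ys) v)" for X
        by (auto elim: eval_PrimRec_SucE intro: eval.intros)
      then show ?case by simp
    qed
    with Cons show ?thesis by simp
  qed
next
  case (Mu f)
  note [measurable] = Mu.IH
  have "eval X (Mu f) xs v \<longleftrightarrow> eval X f (v # xs) 0 \<and> (\<forall>m<v. \<exists>y. eval X f (m # xs) y \<and> y > 0)" for X
    by (auto elim!: eval_MuE intro: eval.Mu)
  then show ?case by simp
qed

text \<open>The quantifier over sequences is uncountable; it is traded for one over programs, with
  the sequence expressed through pairs of values.\<close>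

lemma sets_computes_ascending:
  "{X. \<exists>f. computable_in X f \<and> ascending r f} \<in> cantor.events"
proof -
  have "(\<exists>f. computable_in X f \<and> ascending r f) \<longleftrightarrow>
      (\<exists>e. \<forall>m n. m < n \<longrightarrow> (\<exists>a c. eval X e [m] a \<and> eval X e [n] c \<and> (a, c) \<in> r - Id))" for X
  proof
    assume "\<exists>e. \<forall>m n. m < n \<longrightarrow> (\<exists>a c. eval X e [m] a \<and> eval X e [n] c \<and> (a, c) \<in> r - Id)"
    then obtain e where
      e: "\<And>m n. m < n \<Longrightarrow> \<exists>a c. eval X e [m] a \<and> eval X e [n] c \<and> (a, c) \<in> r - Id"
      by blast
    \<comment> \<open>Totality comes from comparing \<open>m\<close> with its successor.\<close>
    then have "\<forall>m. \<exists>a. eval X e [m] a" by (meson lessI)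
    then obtain f where f: "\<And>m. eval X e [m] (f m)" by metis
    then have "ascending r f"
      unfolding ascending_def using e eval_deterministic by metis
    with f show "\<exists>f. computable_in X f \<and> ascending r f" by (auto simp: computable_in_def)
  next
    assume "\<exists>f. computable_in X f \<and> ascending r f"
    then show "\<exists>e. \<forall>m n. m < n \<longrightarrow> (\<exists>a c. eval X e [m] a \<and> eval X e [n] c \<and> (a, c) \<in> r - Id)"
      unfolding computable_in_def ascending_def by metis
  qed
  then show ?thesis by (simp only:) (rule events_CollectI, measurable)
qed

section \<open>Invariance under finite changes of the oracle\<close>

primrec subst_oracle :: "recf \<Rightarrow> recf \<Rightarrow> recf" where
  "subst_oracle g Zero = Zero"
| "subst_oracle g Succ = Succ"
| "subst_oracle g (Proj i) = Proj i"
| "subst_oracle g Oracle = g"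
| "subst_oracle g (Comp f fs) = Comp (subst_oracle g f) (map (subst_oracle g) fs)"
| "subst_oracle g (PrimRec f h) = PrimRec (subst_oracle g f) (subst_oracle g h)"
| "subst_oracle g (Mu f) = Mu (subst_oracle g f)"

lemma eval_subst_oracle:
  assumes g: "\<And>x. eval Y g [x] (of_bool (X x))"
  shows "eval X e xs v \<Longrightarrow> eval Y (subst_oracle g e) xs v"
proof (induction rule: eval.induct)
  case (Comp xs gs ys f z)
  then show ?case
    by (auto intro!: eval.Comp[of _ _ _ ys] simp: list_all2_conv_all_nth)
next
  case (Mu f n xs)
  then show ?case by (auto intro!: eval.Mu)
next
  case (Oracle x)
  show ?case using g[of x] by (simp only: subst_oracle.simps)
qed (auto intro: eval.intros)

lemma computable_in_trans:
  assumes "cdec True Y X" "computable_in X f"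
  shows "computable_in Y f"
  using assms eval_subst_oracle unfolding crec_iff computable_in_def by metis

lemma cdec_finite:
  assumes "finite A"
  shows "cdec b X (\<lambda>x. x \<in> A)"
  using assms
proof induction
  case (insert a A)
  then show ?case unfolding insert_iff by (intro crec_intros)
qed (simp add: crec_const)

text \<open>The erased bits form a finite set, which a program can contain as a table.\<close>

lemma computable_in_finite_change:
  "computable_in (\<lambda>i. n \<le> i \<and> X i) f \<longleftrightarrow> computable_in X f"
proof
  have "cdec True X (\<lambda>i. n \<le> i \<and> X i)" by (intro crec_intros crec_oracle)
  then show "computable_in (\<lambda>i. n \<le> i \<and> X i) f \<Longrightarrow> computable_in X f"
    by (rule computable_in_trans)
  let ?Y = "\<lambda>i. n \<le> i \<and> X i"
  have "cdec True ?Y (\<lambda>i. i \<in> {i. i < n \<and> X i} \<or> ?Y i)"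
    by (rule cdec_disj[OF cdec_finite crec_oracle[OF crec_id]]) simp
  moreover have "i \<in> {i. i < n \<and> X i} \<or> ?Y i \<longleftrightarrow> X i" for i by auto
  ultimately have "cdec True ?Y X" by (simp only:)
  then show "computable_in X f \<Longrightarrow> computable_in ?Y f"
    by (rule computable_in_trans)
qed

text \<open>By \<open>change\<close>, \<open>C\<close> is its own preimage under erasing the first
  \<open>n\<close> bits. Since that map depends only on the later bits, \<open>C\<close> is a tail
  event.\<close>

lemma zero_one_law:
  assumes C: "C \<in> cantor.events" and change: "\<And>n X. (\<lambda>i. n \<le> i \<and> X i) \<in> C \<longleftrightarrow> X \<in> C"
  shows "cantor.prob C = 0 \<or> cantor.prob C = 1"
proof (rule cantor.kolmogorov_0_1_law)
  interpret product_prob_space "\<lambda>_. measure_pmf (bernoulli_pmf (1 / 2))" "UNIV :: nat set" ..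
  let ?B = "measure_pmf (bernoulli_pmf (1 / 2))"
  define A where "A i = {(\<lambda>X. X i) -` S \<inter> space cantor_measure | S. S \<in> sets ?B}" for i :: nat
  show "sigma_algebra (space cantor_measure) (A i)" for i
    unfolding A_def using sets.sigma_algebra_axioms[of "vimage_algebra UNIV (\<lambda>X. X i) ?B"]
    by (simp add: sets_vimage_algebra2)
  have rv: "(\<lambda>X. X i) \<in> cantor_measure \<rightarrow>\<^sub>M ?B" for i
    unfolding cantor_measure_def by (rule measurable_component_singleton) simp
  \<comment> \<open>The bits are independent because their joint law is the product measure
    itself.\<close>
  have "cantor.indep_vars (\<lambda>_. ?B) (\<lambda>i X. X i) UNIV"
  proof (subst cantor.indep_vars_iff_distr_eq_PiM)
    have "distr cantor_measure ?B (\<lambda>X. X i) = ?B" for i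
      unfolding cantor_measure_def by (rule PiM_component) simp
    then show "distr cantor_measure (\<Pi>\<^sub>M i\<in>UNIV. ?B) (\<lambda>X. \<lambda>i\<in>UNIV. X i) =
        (\<Pi>\<^sub>M i\<in>UNIV. distr cantor_measure ?B (\<lambda>X. X i))"
      by (simp add: cantor_measure_def[symmetric] restrict_UNIV distr_id2)
  qed (use rv in auto)
  then show "cantor.indep_sets A UNIV"
    unfolding cantor.indep_vars_def2 A_def by blast
  have "C \<in> sigma_sets UNIV (\<Union> (A ` {n..}))" for n
  proof -
    define N where "N = sigma UNIV (\<Union> (A ` {n..}))"
    have N: "space N = UNIV" "sets N = sigma_sets UNIV (\<Union> (A ` {n..}))"
      by (auto simp: N_def)
    \<comment> \<open>Coordinates below \<open>n\<close> become constant, and the others are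
      measurable for \<open>N\<close>, the \<sigma>-algebra of the bits from \<open>n\<close>
      on.\<close>
    have "(\<lambda>X i. n \<le> i \<and> X i) \<in> N \<rightarrow>\<^sub>M (\<Pi>\<^sub>M i\<in>UNIV. ?B)"
    proof (rule measurable_PiM_single')
      show "(\<lambda>X. n \<le> i \<and> X i) \<in> N \<rightarrow>\<^sub>M ?B" for i
      proof (cases "n \<le> i")
        case True
        then have "A i \<subseteq> sets N" unfolding N by (auto intro: sigma_sets.Basic)
        then have "(\<lambda>X. X i) \<in> N \<rightarrow>\<^sub>M ?B"
          by (intro measurableI) (auto simp: A_def N(1))
        with True show ?thesis by simp
      qed simp
    qed auto
    then have "(\<lambda>X i. n \<le> i \<and> X i) -` C \<inter> space N \<in> sets N"
      using C unfolding cantor_measure_def by (rule measurable_sets)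
    then show ?thesis using change by (simp add: N vimage_def)
  qed
  then show "C \<in> cantor.tail_events A"
    unfolding cantor.tail_events_def by simp
qed

theorem theorem7p8:
  shows "\<exists>r :: nat rel.
    linear_order r \<and> computable_rel r \<and>
    \<not> (\<exists>f. computable f \<and> (ascending r f \<or> descending r f)) \<and>
    emeasure cantor_measure {X. \<exists>f. computable_in X f \<and> ascending r f} = 1"
proof (intro exI conjI)
  let ?C = "{X. \<exists>f. computable_in X f \<and> ascending node_order f}"
  show "linear_order node_order" "computable_rel node_order"
    by (rule linear_order_node_order computable_rel_node_order)+
  show "\<not> (\<exists>f. computable f \<and> (ascending node_order f \<or> descending node_order f))"
    using no_computable_monotone_sequence by blast
  have C: "?C \<in> cantor.events" by (rule sets_computes_ascending)
  have sub: "{X. infinite {s. node (path X s)}} \<subseteq> ?C"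
    using computes_ascending by blast
  have "1 / 2 \<le> cantor.prob ?C"
    using cantor.finite_measure_mono[OF sub C] prob_infinitely_many_nodes by linarith
  \<comment> \<open>Invariance under erasing initial bits yields the dichotomy, and the lower bound
    1/2 excludes 0.\<close>
  moreover have "cantor.prob ?C = 0 \<or> cantor.prob ?C = 1"
    by (rule zero_one_law[OF C]) (simp add: computable_in_finite_change)
  ultimately show "emeasure cantor_measure ?C = 1"
    by (simp add: cantor.emeasure_eq_measure)
qed

end
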